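(* Let $G$ be a finitely generated branch group. Then $G$ has Serre's property (FA) if and only if $G$ admits no epimorphism onto $\mathbb{Z}$ and no epimorphism onto the infinite dihedral group $\mathbb{D}_\infty$.
   Context: Property (FA): for every simplicial tree $T$ on which $G$ acts simplicially and without inversion of edges, the set $T^G$ of vertices fixed by $G$ is nonempty. Branch group: here "branch" means algebraically branch. A group $G$ is algebraically branch if there exist a sequence of integers $\{k_n\}_{n\ge 0}$ and two decreasing sequences of subgroups $\{R_n\}_{n\ge 0}$ and $\{V_n\}_{n\ge 0}$ of $G$ such that: (1) $k_0=1$ and $k_n\ge 2$ for all $n>0$; (2) for all $n$, $R_n = V_n^{(1)}\times V_n^{(2)}\times\dots\times V_n^{(k_0k_1\cdots k_n)}$ (internal direct product), where each $V_n^{(j)}$ is an isomorphic copy of $V_n$; (3) for all $n$, the decomposition of $R_{n+1}$ refines that of $R_n$: the $j$-th factor $V_n^{(j)}$, $1\le j\le k_0\cdots k_n$, contains the $j$-th block of $k_{n+1}$ consecutive factors $V_{n+1}^{((j-1)k_{n+1}+1)}\times\dots\times V_{n+1}^{(jk_{n+1})}$ of $R_{n+1}$; (4) each $R_n$ is normal in $G$ and $\bigcap_{n\ge 0} R_n = 1$; (5) for all $n$, the conjugation action of $G$ on $R_n$ permutes transitively the factors in (2); (6) for all $n$, the index $[G:R_n]$ is finite. *)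

theory Defs
  imports "HOL-Algebra.Elementary_Groups" "HOL-Algebra.Group_Action" "Graph_Theory.Graph_Theory"
begin

definition finitely_generated_group :: "('a, 'b) monoid_scheme \<Rightarrow> bool" where
  "finitely_generated_group G \<longleftrightarrow>
     group G \<and> (\<exists>S. finite S \<and> S \<subseteq> carrier G \<and> generate G S = carrier G)"

(* The semidirect product of the integers with the group of order 2 acting by negation;
   the second component is True for the reflections. *)
definition infinite_dihedral_group :: "(int \<times> bool) monoid" where
  "infinite_dihedral_group =
     \<lparr>carrier = UNIV,
      monoid.mult = (\<lambda>(a, s) (b, t). (a + (if s then - b else b), s \<noteq> t)),
      one = (0, False)\<rparr>"

lemma group_infinite_dihedral_group: "group infinite_dihedral_group"
proof (rule groupI)
  fix x :: "int \<times> bool"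
  obtain a s where x: "x = (a, s)" by (cases x)
  show "\<exists>y\<in>carrier infinite_dihedral_group.
      y \<otimes>\<^bsub>infinite_dihedral_group\<^esub> x = \<one>\<^bsub>infinite_dihedral_group\<^esub>"
    by (rule bexI [of _ "(if s then a else - a, s)"])
      (auto simp: x infinite_dihedral_group_def)
qed (auto simp: infinite_dihedral_group_def split: prod.splits if_splits)

definition internal_direct_product ::
  "('a, 'b) monoid_scheme \<Rightarrow> 'i set \<Rightarrow> ('i \<Rightarrow> 'a set) \<Rightarrow> 'a set \<Rightarrow> bool" where
  "internal_direct_product G I H K \<longleftrightarrow>
     subgroup K G \<and>
     (\<forall>i\<in>I. H i \<lhd> G\<lparr>carrier := K\<rparr>) \<and>
     generate G (\<Union>i\<in>I. H i) = K \<and>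
     (\<forall>i\<in>I. H i \<inter> generate G (\<Union>j\<in>I - {i}. H j) = {\<one>\<^bsub>G\<^esub>})"

(* W n j is the j-th factor of R n, where j ranges over 1, ..., k 0 * ... * k n. *)
locale branch_structure = group G for G (structure) +
  fixes k :: "nat \<Rightarrow> nat"
    and R V :: "nat \<Rightarrow> 'a set"
    and W :: "nat \<Rightarrow> nat \<Rightarrow> 'a set"
  assumes subgroup_R: "subgroup (R n) G"
    and subgroup_V: "subgroup (V n) G"
    and decreasing_R: "antimono R"
    and decreasing_V: "antimono V"
    and k_0: "k 0 = 1"
    and k_ge_2: "n > 0 \<Longrightarrow> k n \<ge> 2"
    and direct_product: "internal_direct_product G {1..\<Prod>i\<le>n. k i} (W n) (R n)"
    and factor_iso: "j \<in> {1..\<Prod>i\<le>n. k i} \<Longrightarrow> G\<lparr>carrier := W n j\<rparr> \<cong> G\<lparr>carrier := V n\<rparr>"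
    and refinement: "j \<in> {1..\<Prod>i\<le>n. k i} \<Longrightarrow>
          generate G (\<Union>i\<in>{(j - 1) * k (Suc n) + 1..j * k (Suc n)}. W (Suc n) i) \<subseteq> W n j"
    and normal_R: "R n \<lhd> G"
    and trivial_Inter: "(\<Inter>n. R n) = {\<one>}"
    and transitive_on_factors:
          "transitive_action G (W n ` {1..\<Prod>i\<le>n. k i})
             (\<lambda>g. \<lambda>H\<in>W n ` {1..\<Prod>i\<le>n. k i}. g <# H #> inv g)"
    and finite_index: "finite (rcosets (R n))"

definition branch_group :: "('a, 'b) monoid_scheme \<Rightarrow> bool" where
  "branch_group G \<longleftrightarrow> (\<exists>k R V W. branch_structure G k R V W)"

(* An undirected edge is a pair of opposite arcs, so a graph without loops and multiple edges
   is a symmetric loop-free relation.  Going back and forth along an edge is a cycle of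
   length 2 of the digraph; the circuits of the undirected graph are the cycles of length
   at least 3.  The constant tree of Graph_Theory is not suitable here: it forbids
   directed cycles, hence every pair of opposite arcs. *)
locale simplicial_tree = pair_bidirected_digraph T for T :: "'v pair_pre_digraph" +
  assumes connected: "strongly_connected (with_proj T)"
    and no_circuits: "cycle p \<Longrightarrow> length p \<le> 2"

locale simplicial_tree_action =
  simplicial_tree T + group_action G "pverts T" \<phi>
  for T :: "'v pair_pre_digraph" and G :: "('a, 'b) monoid_scheme" (structure)
    and \<phi> :: "'a \<Rightarrow> 'v \<Rightarrow> 'v" +
  assumes simplicial:
      "\<lbrakk>g \<in> carrier G; (x, y) \<in> parcs T\<rbrakk> \<Longrightarrow> (\<phi> g x, \<phi> g y) \<in> parcs T"
    and no_inversion: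
      "\<lbrakk>g \<in> carrier G; (x, y) \<in> parcs T\<rbrakk> \<Longrightarrow> \<not> (\<phi> g x = y \<and> \<phi> g y = x)"

definition fixed_vertices ::
  "'v pair_pre_digraph \<Rightarrow> ('a, 'b) monoid_scheme \<Rightarrow> ('a \<Rightarrow> 'v \<Rightarrow> 'v) \<Rightarrow> 'v set" where
  "fixed_vertices T G \<phi> = {x \<in> pverts T. \<forall>g\<in>carrier G. \<phi> g x = x}"

(* Quantification over all trees has to be split by the type of the vertices: this is
   property (FA) for the trees whose vertex set is a set of elements of 'v, and property (FA)
   itself is its validity for every type 'v.  Restricting to infinite 'v loses nothing,
   as every tree can be renamed into a larger type. *)
definition property_FA :: "'v itself \<Rightarrow> ('a, 'b) monoid_scheme \<Rightarrow> bool" where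
  "property_FA TYPE('v) G \<longleftrightarrow>
     (\<forall>(T :: 'v pair_pre_digraph) \<phi>.
        simplicial_tree_action T G \<phi> \<longrightarrow> fixed_vertices T G \<phi> \<noteq> {})"

end

theory Submission
  imports Defs "HOL-Library.Countable"
begin

text \<open>
  The existence of an epimorphism onto \<open>\<int>\<close> or onto the infinite dihedral group
  \<open>D\<close> contradicts (FA), because both groups act without a fixed vertex on the integers,
  viewed as a line; the action of \<open>D\<close> is freed of inversions by barycentric subdivision
  (\<open>translation_hom_not_FA\<close>).

  Conversely, let a finitely generated branch group \<open>G\<close> act on a tree without a fixed
  vertex. An element is called elliptic if it fixes a vertex and hyperbolic otherwise; a hyperbolic
  element translates a unique line, its axis. If all elements of \<open>G\<close> were elliptic, the
  finitely many generators would have a common fixed vertex, by Serre's lemma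
  (\<open>generators_common_fixpoint\<close>). So \<open>G\<close> contains a hyperbolic element, and a
  power of it is a hyperbolic element of \<open>R 1\<close>, which has finite index.

  Now \<open>R 1\<close> is a product of at least two commuting factors that are conjugate in
  \<open>G\<close>. Two commuting elliptic elements have a common fixed vertex, so if all elements of
  the factors were elliptic, all elements of \<open>R 1\<close> would be. Hence one factor, and by
  conjugation every factor, contains a hyperbolic element. Commuting elements preserve each other's
  axes, so the hyperbolic elements chosen in two different factors have the same axis, and each
  factor commutes with one of the two and preserves this line. Thus \<open>R 1\<close> preserves the
  line, and so does \<open>G\<close>, because a conjugate of a hyperbolic element of \<open>R 1\<close> lies in
  \<open>R 1\<close> and therefore has the same axis
  (\<open>invariant_line_of_commuting_conjugates\<close>). The action of \<open>G\<close> on this line is a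
  homomorphism to \<open>D\<close> whose image contains a nontrivial translation, and such an image is
  isomorphic to \<open>\<int>\<close> or to \<open>D\<close> (\<open>dihedral_hom_epi\<close>).

  The geometry of the tree is expressed through the distance of vertices alone. Its essential
  property is that among the neighbours of a vertex at most one does not lie farther from a given
  vertex (\<open>nearer_neighbour_unique\<close>).
\<close>

section \<open>The distance of a simplicial tree\<close>

context simplicial_tree
begin

abbreviation adj :: "'v \<Rightarrow> 'v \<Rightarrow> bool" where
  "adj x y \<equiv> (x, y) \<in> parcs T"

lemma adj_sym: "adj x y \<Longrightarrow> adj y x"
  using sym_arcs by (auto simp: symmetric_def dest: symD)

lemma adj_irrefl: "\<not> adj x x"
  using no_loops' by auto

lemma adj_verts: "adj x y \<Longrightarrow> x \<in> pverts T" "adj x y \<Longrightarrow> y \<in> pverts T"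
  by (auto dest: in_arcsD1 in_arcsD2)

text \<open>
  A shortest closed piece of a closed walk visits no vertex twice, so it is a cycle; as the walk
  never turns back and there are no loops, the cycle has length at least 3. The walk may turn back
  at its base point, which is what makes the statement applicable to two different walks with the
  same ends.
\<close>

lemma reduced_walk_not_closed:
  assumes "n \<ge> 1" "\<And>i. i < n \<Longrightarrow> adj (w i) (w (Suc i))"
    and "\<And>i. Suc i < n \<Longrightarrow> w i \<noteq> w (Suc (Suc i))"
  shows "w 0 \<noteq> w n"
  using assms
proof (induction n arbitrary: w rule: less_induct)
  case (less n)
  note adj = less.prems(2) and red = less.prems(3)
  show ?case
  proof
    assume closed: "w 0 = w n"
    show False
    proof (cases "inj_on w {1..n}")
      case True
      define walk where "walk m j = map (\<lambda>i. (w i, w (Suc i))) [m..<m + j]" for m j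
      have walk_Suc: "walk m (Suc j) = (w m, w (Suc m)) # walk (Suc m) j" for m j
        by (simp add: walk_def upt_conv_Cons del: upt_Suc)
      have cas: "pcas (w m) (walk m j) (w (m + j))" for m j
      proof (induction j arbitrary: m)
        case 0 then show ?case by (simp add: walk_def)
      next
        case (Suc j) then show ?case using Suc[of "Suc m"] by (simp add: walk_Suc)
      qed
      have verts: "pawalk_verts (w m) (walk m j) = map w [m..<Suc (m + j)]" for m j
      proof (induction j arbitrary: m)
        case 0 then show ?case by (simp add: walk_def)
      next
        case (Suc j) then show ?case
          by (simp add: walk_Suc upt_conv_Cons del: upt_Suc)
      qed
      have "awalk (w 0) (walk 0 n) (w n)"
        unfolding awalk_def using cas[of 0 n] adj less.prems(1) adj_verts(1)[OF adj[of 0]]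
        by (auto simp: walk_def)
      moreover have "distinct (tl (pawalk_verts (w 0) (walk 0 n)))"
        using True by (simp add: verts upt_conv_Cons distinct_map atLeastLessThanSuc_atLeastAtMost del: upt_Suc)
      moreover have "walk 0 n \<noteq> []"
        using less.prems(1) by (simp add: walk_def)
      ultimately have "cycle (walk 0 n)"
        unfolding cycle_def using closed by auto
      then have "length (walk 0 n) \<le> 2" by (rule no_circuits)
      then consider "n = 1" | "n = 2" using less.prems(1) by (force simp: walk_def)
      then show False
        using adj[of 0] red[of 0] closed adj_irrefl by cases (auto simp: numeral_2_eq_2)
    next
      case False
      then obtain i j where ij: "i \<ge> 1" "i < j" "j \<le> n" "w i = w j"
        unfolding inj_on_def by (metis atLeastAtMost_iff linorder_neqE_nat)
      \<comment> \<open>the closed piece between two visits of the same vertex is a shorter counterexample\<close>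
      have "w (i + 0) \<noteq> w (i + (j - i))"
        by (rule less.IH) (use ij adj red in auto)
      with ij show False by simp
    qed
  qed
qed

definition vdist :: "'v \<Rightarrow> 'v \<Rightarrow> nat" where
  "vdist x y = (LEAST n. (x, y) \<in> parcs T ^^ n)"

lemma vdist_le: "(x, y) \<in> parcs T ^^ n \<Longrightarrow> vdist x y \<le> n"
  unfolding vdist_def by (rule Least_le)

lemma vdist_relpow:
  assumes "x \<in> pverts T" "y \<in> pverts T"
  shows "(x, y) \<in> parcs T ^^ vdist x y"
proof -
  have "(x, y) \<in> (parcs T)\<^sup>*"
    using connected assms reachable_rtranclI[of "with_proj T" x y] by (auto simp: strongly_connected_def)
  then obtain n where "(x, y) \<in> parcs T ^^ n"
    by (auto dest: rtrancl_imp_relpow)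
  then show ?thesis unfolding vdist_def by (rule LeastI)
qed

lemma relpow_adj_sym: "(x, y) \<in> parcs T ^^ n \<Longrightarrow> (y, x) \<in> parcs T ^^ n"
proof (induction n arbitrary: y)
  case (Suc n)
  then show ?case by (metis adj_sym relpow_Suc_E relpow_Suc_I2)
qed simp

lemma vdist_sym: "vdist x y = vdist y x"
  unfolding vdist_def by (metis relpow_adj_sym)

lemma vdist_triangle:
  assumes "x \<in> pverts T" "y \<in> pverts T" "z \<in> pverts T"
  shows "vdist x z \<le> vdist x y + vdist y z"
  using assms by (intro vdist_le) (auto simp: relpow_add intro!: relcompI vdist_relpow)

lemma vdist_eq_0: "x \<in> pverts T \<Longrightarrow> y \<in> pverts T \<Longrightarrow> vdist x y = 0 \<longleftrightarrow> x = y"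
  using vdist_relpow[of x y] vdist_le[of x y 0] by auto

lemma vdist_same [simp]: "vdist x x = 0"
  using vdist_le[of x x 0] by auto

lemma vdist_adj: "adj x y \<Longrightarrow> vdist x y = 1"
  using vdist_le[of x y 1] vdist_eq_0[of x y] adj_verts[of x y] adj_irrefl[of x]
  by (cases "vdist x y") auto

lemma vdist_adj_le:
  assumes "adj x z" "y \<in> pverts T"
  shows "vdist z y \<le> Suc (vdist x y)"
  using vdist_triangle[of z x y] vdist_adj[OF adj_sym[OF assms(1)]] adj_verts[OF assms(1)] assms(2)
  by simp

lemma shortest_walk:
  assumes "x \<in> pverts T" "y \<in> pverts T"
  obtains f where "f 0 = x" "f (vdist x y) = y" "\<And>i. i < vdist x y \<Longrightarrow> adj (f i) (f (Suc i))"
    "\<And>i. i \<le> vdist x y \<Longrightarrow> f i \<in> pverts T \<and> vdist x (f i) = i \<and> vdist (f i) y = vdist x y - i"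
proof -
  let ?n = "vdist x y"
  obtain f where f: "f 0 = x" "f ?n = y" "\<And>i. i < ?n \<Longrightarrow> adj (f i) (f (Suc i))"
    using vdist_relpow[OF assms] by (auto simp: relpow_fun_conv)
  have walk: "(f i, f (i + j)) \<in> parcs T ^^ j" if "i + j \<le> ?n" for i j
    unfolding relpow_fun_conv using that f(3) by (intro exI[of _ "\<lambda>k. f (i + k)"]) auto
  have verts: "f i \<in> pverts T" if "i \<le> ?n" for i
    using that f assms adj_verts(1)[OF f(3)] by (cases "i = ?n") auto
  have "vdist x (f i) = i \<and> vdist (f i) y = ?n - i" if "i \<le> ?n" for i
    using vdist_triangle[OF assms(1) verts[OF that] assms(2)]
      vdist_le[OF walk[of 0 i]] vdist_le[OF walk[of i "?n - i"]] that f(1,2) by (simp, linarith)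
  with f verts show thesis using that by blast
qed

lemma nearer_neighbour_exists:
  assumes "x \<in> pverts T" "y \<in> pverts T" "x \<noteq> y"
  obtains z where "adj x z" "Suc (vdist z y) = vdist x y"
proof -
  have "vdist x y \<noteq> 0" using assms by (simp add: vdist_eq_0)
  moreover obtain f where f: "f 0 = x" "\<And>i. i < vdist x y \<Longrightarrow> adj (f i) (f (Suc i))"
    "\<And>i. i \<le> vdist x y \<Longrightarrow> vdist (f i) y = vdist x y - i"
    using shortest_walk[OF assms(1,2)] by metis
  ultimately show thesis using f(2)[of 0] f(3)[of 1] f(1) by (intro that[of "f 1"]) auto
qed

text \<open>
  Shortest walks from \<open>y\<close> to \<open>z\<close> and to \<open>z'\<close>, both
  prolonged to \<open>x\<close>, would together form a reduced closed walk based at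
  \<open>y\<close>. All later arguments about the tree rest on this lemma.
\<close>

lemma nearer_neighbour_unique:
  assumes "adj x z" "adj x z'" "y \<in> pverts T"
    and "vdist z y \<le> vdist x y" "vdist z' y \<le> vdist x y"
  shows "z = z'"
proof (rule ccontr)
  assume "z \<noteq> z'"
  note verts = adj_verts[OF assms(1)] adj_verts[OF assms(2)] assms(3)
  let ?m = "vdist y z" and ?m' = "vdist y z'"
  obtain f where f: "f 0 = y" "f ?m = z" "\<And>i. i < ?m \<Longrightarrow> adj (f i) (f (Suc i))"
    "\<And>i. i \<le> ?m \<Longrightarrow> vdist y (f i) = i"
    using shortest_walk[of y z] verts by metis
  obtain f' where f': "f' 0 = y" "f' ?m' = z'" "\<And>i. i < ?m' \<Longrightarrow> adj (f' i) (f' (Suc i))"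
    "\<And>i. i \<le> ?m' \<Longrightarrow> vdist y (f' i) = i"
    using shortest_walk[of y z'] verts by metis
  have le: "?m \<le> vdist y x" "?m' \<le> vdist y x"
    using assms(4,5) by (simp_all add: vdist_sym)
  \<comment> \<open>from y along f to z, then through x to z', and along f' back to y\<close>
  define w where "w i = (if i \<le> ?m then f i else if i = Suc ?m then x else f' (?m + ?m' + 2 - i))" for i
  have "w 0 \<noteq> w (?m + ?m' + 2)"
  proof (rule reduced_walk_not_closed)
    fix i assume i: "i < ?m + ?m' + 2"
    show "adj (w i) (w (Suc i))"
    proof (cases "i \<le> Suc ?m")
      case True
      then consider "i < ?m" | "i = ?m" | "i = Suc ?m" by linarith
      then show ?thesis
        by cases (use f f' assms(1,2) in \<open>auto simp: w_def intro: adj_sym\<close>)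
    next
      case False
      let ?j = "?m + ?m' + 2 - Suc i"
      have "?m + ?m' + 2 - i = Suc ?j" using i by simp
      then have "w i = f' (Suc ?j)" "w (Suc i) = f' ?j" using False by (simp_all add: w_def)
      moreover have "?j < ?m'" using False i by linarith
      ultimately show ?thesis using f'(3)[of ?j] adj_sym by simp
    qed
  next
    fix i assume i: "Suc i < ?m + ?m' + 2"
    consider "Suc (Suc i) \<le> ?m" | "Suc i = ?m" | "i = ?m" | "i = Suc ?m" | "i > Suc ?m" by linarith
    then show "w i \<noteq> w (Suc (Suc i))"
    proof cases
      case 1
      then show ?thesis using f(4)[of i] f(4)[of "Suc (Suc i)"] by (auto simp: w_def)
    next
      case 2
      then show ?thesis using f(4)[of i] le by (auto simp: w_def)
    next
      case 3
      then show ?thesis using f f' \<open>z \<noteq> z'\<close> by (auto simp: w_def)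
    next
      case 4
      then have "?m + ?m' + 2 - Suc (Suc i) = ?m' - 1" "?m' \<ge> 1" using i by auto
      then show ?thesis using 4 f'(4)[of "?m' - 1"] le by (auto simp: w_def)
    next
      case 5
      define k where "k = ?m + ?m' - i"
      have k: "?m + ?m' + 2 - i = k + 2" "?m + ?m' + 2 - Suc (Suc i) = k" "k + 2 \<le> ?m'"
        using 5 i by (auto simp: k_def)
      then have "w i = f' (k + 2)" "w (Suc (Suc i)) = f' k" using 5 by (simp_all add: w_def)
      then show ?thesis using f'(4)[of k] f'(4)[of "k + 2"] k(3) by auto
    qed
  qed simp
  then show False using f f' by (simp add: w_def)
qed

text \<open>
  A tree is bipartite: if \<open>x\<close> and its neighbour \<open>z\<close> were equally far
  from \<open>y\<close>, then neither \<open>z\<close> nor the next vertex on the way from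
  \<open>x\<close> to \<open>y\<close> would lie farther from \<open>y\<close> than
  \<open>x\<close>.
\<close>

lemma vdist_adj_neq:
  assumes "adj x z" "y \<in> pverts T"
  shows "vdist z y \<noteq> vdist x y"
proof
  assume eq: "vdist z y = vdist x y"
  have "x \<noteq> y" using eq assms adj_verts[OF assms(1)] adj_irrefl by (metis vdist_eq_0)
  then obtain z' where z': "adj x z'" "Suc (vdist z' y) = vdist x y"
    using nearer_neighbour_exists adj_verts(1)[OF assms(1)] assms(2) by blast
  then have "z = z'" using nearer_neighbour_unique[OF assms(1) z'(1) assms(2)] eq by simp
  with z' eq show False by simp
qed

text \<open>
  The geodesic from \<open>p\<close> to \<open>q\<close> and that from \<open>q\<close> to
  \<open>r\<close> join to a geodesic as soon as they leave \<open>q\<close> through different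
  neighbours: walking on from \<open>q\<close> towards \<open>r\<close>, each step leads away from
  \<open>p\<close>, because the vertex just left is the only neighbour nearer to \<open>p\<close>.
\<close>

lemma vdist_concat:
  assumes "p \<in> pverts T" "r \<in> pverts T" "adj q z" "vdist z r < vdist q r" "vdist q p < vdist z p"
  shows "vdist p r = vdist p q + vdist q r"
  using assms(3-5)
proof (induction "vdist q r" arbitrary: q z)
  case 0
  then show ?case by simp
next
  case (Suc n)
  note V = adj_verts[OF Suc.prems(1)]
  have z: "vdist z p = Suc (vdist q p)" "vdist q r = Suc (vdist z r)"
    using vdist_adj_le[OF Suc.prems(1) assms(1)] vdist_adj_le[OF adj_sym[OF Suc.prems(1)] assms(2)]
      Suc.prems by auto
  show ?case
  proof (cases "z = r")
    case True
    then show ?thesis using z by (simp add: vdist_sym)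
  next
    case False
    then obtain z2 where z2: "adj z z2" "Suc (vdist z2 r) = vdist z r"
      using nearer_neighbour_exists V assms(2) by blast
    have "z2 \<noteq> q" using z z2 by auto
    then have "vdist z p < vdist z2 p"
      using nearer_neighbour_unique[OF z2(1) adj_sym[OF Suc.prems(1)] assms(1)] z by force
    then show ?thesis using Suc.hyps(1)[of z z2] Suc.hyps(2) z z2 by (simp add: vdist_sym)
  qed
qed

text \<open>
  Geodesics are unique; this is used to see that an automorphism that fixes the ends of a geodesic
  fixes each of its vertices.
\<close>

lemma geodesic_point_unique:
  assumes "a \<in> pverts T" "b \<in> pverts T" "c \<in> pverts T" "c' \<in> pverts T"
    and "vdist a c + vdist c b = vdist a b" "vdist a c' = vdist a c" "vdist c' b = vdist c b"
  shows "c = c'"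
  using assms(3-7)
proof (induction "vdist c a" arbitrary: c c')
  case 0
  then show ?case using assms(1) by (metis vdist_eq_0 vdist_sym)
next
  case (Suc n)
  have nz: "c \<noteq> a" "c' \<noteq> a" using Suc.hyps(2) Suc.prems by (auto simp: vdist_sym[of _ a])
  obtain e where e: "adj c e" "Suc (vdist e a) = vdist c a"
    using nearer_neighbour_exists nz(1) Suc.prems assms(1) by blast
  obtain e' where e': "adj c' e'" "Suc (vdist e' a) = vdist c' a"
    using nearer_neighbour_exists nz(2) Suc.prems assms(1) by blast
  note V = adj_verts[OF e(1)] adj_verts[OF e'(1)]
  have s: "vdist a c = vdist c a" "vdist a e = vdist e a" "vdist a e' = vdist e' a" "vdist a c' = vdist c' a"
    by (simp_all add: vdist_sym)
  have d: "vdist e b = Suc (vdist c b)" "vdist e' b = Suc (vdist c b)"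
    using vdist_adj_le[OF e(1) assms(2)] vdist_adj_le[OF e'(1) assms(2)]
      vdist_triangle[of a e b] vdist_triangle[of a e' b] V assms(1,2) Suc.prems e(2) e'(2) s by linarith+
  have "e = e'"
  proof (rule Suc.hyps(1))
    show "n = vdist e a" "vdist a e + vdist e b = vdist a b" "vdist a e' = vdist a e" "vdist e' b = vdist e b"
      using Suc.hyps(2) e(2) e'(2) d s Suc.prems by linarith+
  qed (use V in blast)+
  have "adj e c" "adj e c'"
    using adj_sym[OF e(1)] adj_sym[OF e'(1)] \<open>e = e'\<close> by simp_all
  moreover have "vdist c b \<le> vdist e b" "vdist c' b \<le> vdist e b"
    using d(1) Suc.prems(5) by linarith+
  ultimately show ?case
    using nearer_neighbour_unique assms(2) by blast
qed

section \<open>Lines in a tree\<close>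

text \<open>
  An injective parametrization of a subtree that is a bi-infinite path; by
  \<open>line_vdist\<close>, not turning back suffices for injectivity.
\<close>

definition line :: "(int \<Rightarrow> 'v) \<Rightarrow> bool" where
  "line a \<longleftrightarrow> (\<forall>i. adj (a i) (a (i + 1)) \<and> a i \<noteq> a (i + 2))"

lemma line_verts: "line a \<Longrightarrow> a i \<in> pverts T"
  unfolding line_def by (metis adj_verts(1))

lemma line_adj: "line a \<Longrightarrow> adj (a i) (a (i + 1))" "line a \<Longrightarrow> adj (a i) (a (i - 1))"
  unfolding line_def using adj_sym by (metis diff_add_cancel)+

lemma line_vdist_aux:
  assumes "line a"
  shows "vdist (a (i + int n)) (a i) = n"
proof (induction n rule: induct_nat_012)
  case 0 then show ?case by simp
next
  case 1 then show ?case using vdist_adj[OF line_adj(1)[OF assms, of i]] by (simp add: vdist_sym)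
next
  case (ge2 n)
  let ?x = "a (i + int n + 1)"
  have "adj ?x (a (i + int n))" "adj ?x (a (i + int n + 2))"
    using line_adj[OF assms, of "i + int n + 1"] by (simp_all add: algebra_simps)
  moreover have "a (i + int n) \<noteq> a (i + int n + 2)" using assms by (simp add: line_def)
  ultimately have "vdist ?x (a i) < vdist (a (i + int n + 2)) (a i)"
    using nearer_neighbour_unique[of ?x "a (i + int n)" "a (i + int n + 2)" "a i"] ge2 line_verts[OF assms]
    by (force simp: algebra_simps)
  moreover have "vdist (a (i + int n + 2)) (a i) \<le> Suc (vdist ?x (a i))"
    using vdist_adj_le \<open>adj ?x (a (i + int n + 2))\<close> line_verts[OF assms] by blast
  ultimately show ?case using ge2 by (simp add: algebra_simps)
qed

lemma line_vdist:
  assumes "line a"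
  shows "vdist (a i) (a j) = nat \<bar>i - j\<bar>"
proof (cases "i \<le> j")
  case True
  then show ?thesis using line_vdist_aux[OF assms, of i "nat (j - i)"] by (simp add: vdist_sym)
next
  case False
  then show ?thesis using line_vdist_aux[OF assms, of j "nat (i - j)"] by simp
qed

lemma line_inj: "line a \<Longrightarrow> a i = a j \<longleftrightarrow> i = j"
  using line_vdist[of a i j] vdist_same[of "a i"] by auto

lemma line_step:
  assumes "line a" "i \<noteq> j"
  obtains k where "adj (a i) (a k)" "\<bar>k - i\<bar> = 1" "\<bar>k - j\<bar> < \<bar>i - j\<bar>"
proof (cases "i < j")
  case True
  then show thesis using line_adj(1)[OF assms(1), of i] by (intro that[of "i + 1"]) auto
next
  case False
  then show thesis using line_adj(2)[OF assms(1), of i] assms(2) by (intro that[of "i - 1"]) auto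
qed

text \<open>
  The vertex \<open>a i\<close> is the projection of \<open>x\<close>, the point of the line
  nearest to \<open>x\<close>: the first step from there along the line increases the distance
  from \<open>x\<close>, so \<open>vdist_concat\<close> applies.
\<close>

lemma line_projection:
  assumes a: "line a" and x: "x \<in> pverts T"
  obtains i where "\<And>j. vdist x (a j) = vdist x (a i) + nat \<bar>i - j\<bar>"
proof -
  obtain i where i: "\<And>j. vdist x (a i) \<le> vdist x (a j)"
    using ex_has_least_nat[of "\<lambda>_. True" 0 "\<lambda>j. vdist x (a j)"] by auto
  have "vdist x (a j) = vdist x (a i) + nat \<bar>i - j\<bar>" for j
  proof (cases "i = j")
    case False
    then obtain k where k: "adj (a i) (a k)" "\<bar>k - j\<bar> < \<bar>i - j\<bar>"
      using line_step[OF a] by metis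
    have "vdist (a i) x < vdist (a k) x"
      using i[of k] vdist_adj_neq[OF k(1) x] by (simp add: vdist_sym)
    then show ?thesis
      using vdist_concat[OF x line_verts[OF a] k(1), of j] k(2) line_vdist[OF a] by simp
  qed simp
  then show thesis by (rule that)
qed

text \<open>
  The geodesic between two vertices with different projections runs through both projections.
\<close>

lemma line_bridge:
  assumes a: "line a" and x: "x \<in> pverts T" and y: "y \<in> pverts T"
    and i: "\<And>k. vdist x (a k) = vdist x (a i) + nat \<bar>i - k\<bar>"
    and j: "\<And>k. vdist y (a k) = vdist y (a j) + nat \<bar>j - k\<bar>"
    and "i \<noteq> j"
  shows "vdist x y = vdist x (a i) + nat \<bar>i - j\<bar> + vdist y (a j)"
proof -
  obtain k where k: "adj (a i) (a k)" "\<bar>k - i\<bar> = 1" "\<bar>k - j\<bar> < \<bar>i - j\<bar>"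
    using line_step[OF a \<open>i \<noteq> j\<close>] by metis
  have "vdist (a k) y < vdist (a i) y"
    using j[of k] j[of i] k(3) unfolding vdist_sym[of _ y] by linarith
  moreover have "vdist (a i) x < vdist (a k) x"
    using i[of k] k(2) by (simp add: vdist_sym[of _ x])
  ultimately have "vdist x y = vdist x (a i) + vdist (a i) y"
    by (rule vdist_concat[OF x y k(1)])
  then show ?thesis using j[of i] by (simp add: vdist_sym[of _ y] abs_minus_commute)
qed

end

section \<open>Elliptic and hyperbolic automorphisms\<close>

lemma int_isometry:
  fixes \<sigma> :: "int \<Rightarrow> int"
  assumes "\<And>i j. \<bar>\<sigma> i - \<sigma> j\<bar> = \<bar>i - j\<bar>"
  obtains c s where "\<And>i. \<sigma> i = c + (if s then - i else i)"
proof
  show "\<sigma> i = \<sigma> 0 + (if \<sigma> 1 = \<sigma> 0 - 1 then - i else i)" for i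
    using assms[of i 0] assms[of i 1] assms[of 1 0] by (auto split: if_splits)
qed

context simplicial_tree_action
begin

sublocale G: group G
  using group_hom by (simp add: group_hom_def)

lemma act_verts: "g \<in> carrier G \<Longrightarrow> x \<in> pverts T \<Longrightarrow> \<phi> g x \<in> pverts T"
  by (rule element_image) auto

lemma act_one: "x \<in> pverts T \<Longrightarrow> \<phi> \<one> x = x"
  using id_eq_one by (metis restrict_apply')

lemma act_mult: "g \<in> carrier G \<Longrightarrow> h \<in> carrier G \<Longrightarrow> x \<in> pverts T \<Longrightarrow> \<phi> (g \<otimes> h) x = \<phi> g (\<phi> h x)"
  by (rule composition_rule)

lemma act_inv: "g \<in> carrier G \<Longrightarrow> x \<in> pverts T \<Longrightarrow> \<phi> (inv g) (\<phi> g x) = x"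
  by (rule orbit_sym_aux) auto

lemma act_eq_iff: "g \<in> carrier G \<Longrightarrow> x \<in> pverts T \<Longrightarrow> y \<in> pverts T \<Longrightarrow> \<phi> g x = \<phi> g y \<longleftrightarrow> x = y"
  using inj_prop by (meson inj_on_eq_iff)

lemma act_relpow: "g \<in> carrier G \<Longrightarrow> (x, y) \<in> parcs T ^^ n \<Longrightarrow> (\<phi> g x, \<phi> g y) \<in> parcs T ^^ n"
proof (induction n arbitrary: y)
  case (Suc n)
  then show ?case by (metis relpow_Suc_E relpow_Suc_I simplicial)
qed simp

lemma act_vdist:
  assumes "g \<in> carrier G" "x \<in> pverts T" "y \<in> pverts T"
  shows "vdist (\<phi> g x) (\<phi> g y) = vdist x y"
proof -
  have le: "vdist (\<phi> g x) (\<phi> g y) \<le> vdist x y"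
    if "g \<in> carrier G" "x \<in> pverts T" "y \<in> pverts T" for g x y
    using that by (intro vdist_le act_relpow vdist_relpow)
  show ?thesis
    using le[OF assms] le[of "inv g" "\<phi> g x" "\<phi> g y"] assms by (simp add: act_inv act_verts)
qed

definition elliptic :: "'a \<Rightarrow> bool" where
  "elliptic g \<longleftrightarrow> (\<exists>x\<in>pverts T. \<phi> g x = x)"

text \<open>
  A translation of a line carries the projection of \<open>x\<close> to that of its image, so that
  the displacement of \<open>x\<close> is governed by its distance \<open>D\<close> from the line.
  Comparing the displacements by \<open>g\<close> and by its square detects whether
  \<open>x\<close> lies on the line.
\<close>

lemma displacement_of_translation:
  assumes g: "g \<in> carrier G" and a: "line a" and tr: "\<And>i. \<phi> g (a i) = a (i + c)" and "c \<noteq> 0"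
    and x: "x \<in> pverts T"
  obtains D where "vdist x (\<phi> g x) = 2 * D + nat \<bar>c\<bar>" "vdist x (\<phi> g (\<phi> g x)) = 2 * D + 2 * nat \<bar>c\<bar>"
    "D = 0 \<longleftrightarrow> x \<in> range a"
proof -
  obtain i where i: "\<And>j. vdist x (a j) = vdist x (a i) + nat \<bar>i - j\<bar>"
    using line_projection[OF a x] by blast
  have shift: "vdist (\<phi> g y) (a k) = vdist (\<phi> g y) (a (j + c)) + nat \<bar>j + c - k\<bar>"
    "vdist (\<phi> g y) (a (j + c)) = vdist y (a j)"
    if y: "y \<in> pverts T" and j: "\<And>k. vdist y (a k) = vdist y (a j) + nat \<bar>j - k\<bar>" for y j k
  proof -
    have eq: "vdist (\<phi> g y) (a k) = vdist y (a (k - c))" for k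
      using act_vdist[OF g y line_verts[OF a], of "k - c"] by (simp add: tr)
    show "vdist (\<phi> g y) (a (j + c)) = vdist y (a j)" by (simp add: eq)
    then show "vdist (\<phi> g y) (a k) = vdist (\<phi> g y) (a (j + c)) + nat \<bar>j + c - k\<bar>"
      using j[of "k - c"] by (simp add: eq algebra_simps)
  qed
  note V = act_verts[OF g x] act_verts[OF g act_verts[OF g x]]
  note s1 = shift[OF x i]
  note s2 = shift[OF V(1) s1(1)]
  show thesis
  proof (rule that)
    show "vdist x (\<phi> g x) = 2 * vdist x (a i) + nat \<bar>c\<bar>"
      using line_bridge[OF a x V(1) i s1(1)] \<open>c \<noteq> 0\<close> s1(2) by simp
    show "vdist x (\<phi> g (\<phi> g x)) = 2 * vdist x (a i) + 2 * nat \<bar>c\<bar>"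
      using line_bridge[OF a x V(2) i s2(1)] \<open>c \<noteq> 0\<close> s1(2) s2(2) by simp
    show "vdist x (a i) = 0 \<longleftrightarrow> x \<in> range a"
      using i vdist_eq_0[OF x line_verts[OF a]] by (metis add_is_0 rangeE rangeI)
  qed
qed

lemma translation_not_elliptic:
  assumes "g \<in> carrier G" "line a" "\<And>i. \<phi> g (a i) = a (i + c)" "c \<noteq> 0"
  shows "\<not> elliptic g"
proof
  assume "elliptic g"
  then obtain x where x: "x \<in> pverts T" "\<phi> g x = x" by (auto simp: elliptic_def)
  with displacement_of_translation[OF assms x(1)] show False
    using \<open>c \<noteq> 0\<close> by (metis add_is_0 vdist_same zero_less_abs_iff zero_less_nat_eq less_numeral_extra(3))
qed

lemma act_on_line:
  assumes g: "g \<in> carrier G" and a: "line a" and inv: "\<phi> g ` range a \<subseteq> range a"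
  obtains c s where "\<And>i. \<phi> g (a i) = a (c + (if s then - i else i))"
proof -
  have "\<forall>i. \<exists>j. \<phi> g (a i) = a j" using inv by blast
  then obtain \<sigma> where \<sigma>: "\<And>i. \<phi> g (a i) = a (\<sigma> i)" by metis
  have "\<bar>\<sigma> i - \<sigma> j\<bar> = \<bar>i - j\<bar>" for i j
    using act_vdist[OF g line_verts[OF a] line_verts[OF a], of i j] line_vdist[OF a] by (simp add: \<sigma>)
  then obtain c s where "\<And>i. \<sigma> i = c + (if s then - i else i)"
    using int_isometry by blast
  then have "\<phi> g (a i) = a (c + (if s then - i else i))" for i
    using \<sigma>[of i] by presburger
  then show thesis by (rule that)
qed

text \<open>
  A reflection of the line is excluded: it fixes a vertex or inverts an edge, according to the
  parity of the sum of the positions that it exchanges.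
\<close>

lemma hyperbolic_translates_line:
  assumes g: "g \<in> carrier G" and a: "line a" and inv: "\<phi> g ` range a \<subseteq> range a" and "\<not> elliptic g"
  obtains c where "c \<noteq> 0" "\<And>i. \<phi> g (a i) = a (i + c)"
proof -
  obtain c s where cs: "\<And>i. \<phi> g (a i) = a (c + (if s then - i else i))"
    using act_on_line[OF g a inv] by blast
  have nofix: "\<phi> g (a i) \<noteq> a i" for i
    using \<open>\<not> elliptic g\<close> line_verts[OF a] by (auto simp: elliptic_def)
  have "\<not> s"
  proof
    assume s
    show False
    proof (cases "even c")
      case True
      then show False using nofix[of "c div 2"] cs[of "c div 2"] \<open>s\<close> by (auto elim!: evenE)
    next
      case False
      then obtain k where "c = 2 * k + 1" by (auto elim: oddE)
      then show False
        using no_inversion[OF g line_adj(1)[OF a, of k]] cs[of k] cs[of "k + 1"] \<open>s\<close> by simp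
    qed
  qed
  then show thesis using cs nofix[of 0] by (intro that[of c]) (auto simp: add.commute)
qed

text \<open>
  For a hyperbolic \<open>g\<close> this is the line that \<open>g\<close> translates. Describing
  it by the distance alone makes its uniqueness and its compatibility with conjugation immediate.
\<close>

definition axis :: "'a \<Rightarrow> 'v set" where
  "axis g = {x \<in> pverts T. vdist x (\<phi> g (\<phi> g x)) = 2 * vdist x (\<phi> g x)}"

lemma invariant_line_eq_axis:
  assumes "g \<in> carrier G" "line a" "\<phi> g ` range a \<subseteq> range a" "\<not> elliptic g"
  shows "range a = axis g"
proof -
  obtain c where c: "c \<noteq> 0" "\<And>i. \<phi> g (a i) = a (i + c)"
    using hyperbolic_translates_line[OF assms] by blast
  have "x \<in> range a \<longleftrightarrow> x \<in> axis g" if x: "x \<in> pverts T" for x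
  proof -
    obtain D where D: "vdist x (\<phi> g x) = 2 * D + nat \<bar>c\<bar>"
      "vdist x (\<phi> g (\<phi> g x)) = 2 * D + 2 * nat \<bar>c\<bar>" "D = 0 \<longleftrightarrow> x \<in> range a"
      using displacement_of_translation[OF assms(1,2) c(2,1) x] .
    then have "x \<in> axis g \<longleftrightarrow> D = 0" using x by (simp add: axis_def)
    with D(3) show ?thesis by simp
  qed
  moreover have "range a \<subseteq> pverts T" "axis g \<subseteq> pverts T"
    using line_verts[OF assms(2)] by (auto simp: axis_def)
  ultimately show ?thesis by blast
qed

lemma act_axis:
  assumes u: "u \<in> carrier G" and g: "g \<in> carrier G"
  shows "\<phi> u ` axis g \<subseteq> axis (u \<otimes> g \<otimes> inv u)"
proof
  fix y assume "y \<in> \<phi> u ` axis g"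
  then obtain x where y: "y = \<phi> u x" and x: "x \<in> pverts T" "vdist x (\<phi> g (\<phi> g x)) = 2 * vdist x (\<phi> g x)"
    by (auto simp: axis_def)
  have "\<phi> (u \<otimes> g \<otimes> inv u) (\<phi> u z) = \<phi> u (\<phi> g z)" if "z \<in> pverts T" for z
    using that u g by (simp add: act_mult act_verts act_inv)
  then show "y \<in> axis (u \<otimes> g \<otimes> inv u)"
    using x u g by (simp add: axis_def y act_vdist act_verts)
qed

lemma elliptic_conj:
  assumes u: "u \<in> carrier G" and g: "g \<in> carrier G" and e: "elliptic (u \<otimes> g \<otimes> inv u)"
  shows "elliptic g"
proof -
  obtain x where x: "x \<in> pverts T" "\<phi> (u \<otimes> g \<otimes> inv u) x = x" using e by (auto simp: elliptic_def)
  define y where "y = \<phi> (inv u) x"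
  have y: "y \<in> pverts T" using x u by (simp add: y_def act_verts)
  have "\<phi> u (\<phi> g y) = x"
    using x u g by (simp add: y_def act_mult act_verts)
  then have "\<phi> g y = y"
    using act_inv[OF u act_verts[OF g y]] by (simp add: y_def)
  then show ?thesis using y by (auto simp: elliptic_def)
qed

lemma act_int_pow_Suc:
  assumes "g \<in> carrier G" "x \<in> pverts T"
  shows "\<phi> (g [^] (q + 1 :: int)) x = \<phi> (g [^] q) (\<phi> g x)"
  using assms by (simp add: G.int_pow_mult act_mult)

text \<open>
  The translates of a segment from \<open>w 0\<close> to its image \<open>w l\<close> fit together
  to a line if there is no turning back at the joints. To state this together with the absence of
  turning points inside the segment, \<open>w\<close> is prolonged by one vertex of the next
  translate.
\<close>

lemma segment_extends_to_invariant_line: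
  fixes w :: "nat \<Rightarrow> 'v"
  assumes g: "g \<in> carrier G" and "l \<ge> 1" and wV: "\<And>i. w i \<in> pverts T"
    and w_adj: "\<And>i. i < l \<Longrightarrow> adj (w i) (w (Suc i))"
    and w_red: "\<And>i. i < l \<Longrightarrow> w i \<noteq> w (Suc (Suc i))"
    and w: "w l = \<phi> g (w 0)" "w (Suc l) = \<phi> g (w 1)"
  obtains a where "line a" "\<phi> g ` range a \<subseteq> range a"
proof -
  \<comment> \<open>position \<open>q * l + r\<close> is occupied by the vertex \<open>w r\<close> of the \<open>q\<close>-th translate\<close>
  define a where "a i = \<phi> (g [^] (i div int l)) (w (nat (i mod int l)))" for i
  have pos: "int l > 0" using \<open>l \<ge> 1\<close> by simp
  have aq0: "a (q * int l + int r) = \<phi> (g [^] q) (w r)" if "r < l" for q r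
    using that pos by (simp add: a_def)
  have aq1: "a (q * int l + int r) = \<phi> (g [^] q) (w r)" if "r \<le> l" for q r
  proof (cases "r = l")
    case True
    then have "q * int l + int r = (q + 1) * int l + int 0" by (simp add: algebra_simps)
    then have "a (q * int l + int r) = a ((q + 1) * int l + int 0)" by (rule arg_cong)
    also have "\<dots> = \<phi> (g [^] (q + 1)) (w 0)" using aq0 \<open>l \<ge> 1\<close> by fastforce
    finally show ?thesis using True act_int_pow_Suc[OF g wV] w(1) by simp
  qed (use aq0 that in simp)
  have aq: "a (q * int l + int r) = \<phi> (g [^] q) (w r)" if "r \<le> Suc l" for q r
  proof (cases "r = Suc l")
    case True
    then have "q * int l + int r = (q + 1) * int l + int 1" by (simp add: algebra_simps)
    then have "a (q * int l + int r) = a ((q + 1) * int l + int 1)" by (rule arg_cong)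
    also have "\<dots> = \<phi> (g [^] (q + 1)) (w 1)" using aq1 \<open>l \<ge> 1\<close> by blast
    finally show ?thesis using True act_int_pow_Suc[OF g wV] w(2) by simp
  qed (use aq1 that in simp)
  have coord: "\<exists>q r. r < l \<and> i = q * int l + int r" for i
  proof (intro exI conjI)
    show "nat (i mod int l) < l" using pos pos_mod_bound[OF pos, of i] by linarith
    show "i = i div int l * int l + int (nat (i mod int l))"
      using pos_mod_sign[OF pos, of i] div_mult_mod_eq[of i "int l"] by linarith
  qed
  have "line a"
    unfolding line_def
  proof
    fix i
    obtain q r where qr: "r < l" "i = q * int l + int r" using coord by blast
    have succ: "i + 1 = q * int l + int (Suc r)" "i + 2 = q * int l + int (Suc (Suc r))"
      using qr by simp_all
    have "a i = \<phi> (g [^] q) (w r)" using aq qr by simp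
    moreover have "a (i + 1) = \<phi> (g [^] q) (w (Suc r))" unfolding succ using aq[of "Suc r"] qr by simp
    moreover have "a (i + 2) = \<phi> (g [^] q) (w (Suc (Suc r)))" unfolding succ using aq[of "Suc (Suc r)"] qr by simp
    ultimately show "adj (a i) (a (i + 1)) \<and> a i \<noteq> a (i + 2)"
      using simplicial w_adj w_red qr(1) g wV by (simp add: act_eq_iff)
  qed
  moreover have "\<phi> g ` range a \<subseteq> range a"
  proof clarify
    fix i
    obtain q r where qr: "r < l" "i = q * int l + int r" using coord by blast
    have "\<phi> g (a i) = \<phi> (g [^] (1 + q)) (w r)"
      using qr aq0[OF qr(1)] g wV by (simp add: G.int_pow_mult act_mult)
    then have "\<phi> g (a i) = a ((1 + q) * int l + int r)" using aq0[OF qr(1)] by simp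
    then show "\<phi> g (a i) \<in> range a" by blast
  qed
  ultimately show thesis by (rule that)
qed

text \<open>
  The geodesic from a vertex of minimal displacement to its image extends to a line: were there a
  turning point at the joint, the next vertex of the geodesic would have smaller displacement, or
  an edge would be inverted.
\<close>

lemma hyperbolic_has_axis:
  assumes g: "g \<in> carrier G" and "\<not> elliptic g"
  obtains a where "line a" "\<phi> g ` range a \<subseteq> range a"
proof -
  have "pverts T \<noteq> {}" using connected by (auto simp: strongly_connected_def)
  then obtain x where x: "x \<in> pverts T"
    and min: "\<And>y. y \<in> pverts T \<Longrightarrow> vdist x (\<phi> g x) \<le> vdist y (\<phi> g y)"
    using ex_has_least_nat[of "\<lambda>x. x \<in> pverts T" _ "\<lambda>x. vdist x (\<phi> g x)"] by blast
  define l where "l = vdist x (\<phi> g x)"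
  note gx = act_verts[OF g x]
  have nofix: "\<phi> g y \<noteq> y" if "y \<in> pverts T" for y
    using that \<open>\<not> elliptic g\<close> by (auto simp: elliptic_def)
  have "l \<ge> 1" using nofix[OF x] vdist_eq_0[OF x gx] by (simp add: l_def Suc_le_eq)
  obtain f where f: "f 0 = x" "f l = \<phi> g x" "\<And>i. i < l \<Longrightarrow> adj (f i) (f (Suc i))"
    and fd: "\<And>i. i \<le> l \<Longrightarrow> f i \<in> pverts T \<and> vdist x (f i) = i \<and> vdist (f i) (\<phi> g x) = l - i"
    using that by (rule shortest_walk[OF x gx, folded l_def])
  have turn: "f (l - 1) \<noteq> \<phi> g (f 1)"
  proof
    assume eq: "f (l - 1) = \<phi> g (f 1)"
    show False
    proof (cases "l = 1")
      case True
      then show False using eq f no_inversion[OF g f(3)[of 0]] by simp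
    next
      case False
      have "l \<le> vdist (f 1) (\<phi> g (f 1))" using min fd[of 1] \<open>l \<ge> 1\<close> by (simp add: l_def)
      moreover have "(f 1, f (1 + (l - 2))) \<in> parcs T ^^ (l - 2)"
        unfolding relpow_fun_conv using False \<open>l \<ge> 1\<close> f(3) by (intro exI[of _ "\<lambda>k. f (1 + k)"]) auto
      moreover have "1 + (l - 2) = l - 1" using False \<open>l \<ge> 1\<close> by linarith
      ultimately have "l \<le> l - 2" using vdist_le eq by fastforce
      then show False using \<open>l \<ge> 1\<close> by linarith
    qed
  qed
  define w where "w i = (if i \<le> l then f i else \<phi> g (f 1))" for i
  have w: "w l = \<phi> g (w 0)" "w (Suc l) = \<phi> g (w 1)" using f \<open>l \<ge> 1\<close> by (simp_all add: w_def)
  have wV: "w i \<in> pverts T" for i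
    using fd[of i] fd[of 1] act_verts[OF g] \<open>l \<ge> 1\<close> by (auto simp: w_def)
  have w_adj: "adj (w i) (w (Suc i))" if "i < l" for i using that f(3) by (simp add: w_def)
  have w_red: "w i \<noteq> w (Suc (Suc i))" if "i < l" for i
  proof (cases "Suc i = l")
    case True
    then show ?thesis using turn by (auto simp: w_def)
  next
    case False
    then show ?thesis using that fd[of i] fd[of "Suc (Suc i)"] by (auto simp: w_def)
  qed
  obtain a where "line a" "\<phi> g ` range a \<subseteq> range a"
    using segment_extends_to_invariant_line[OF g \<open>l \<ge> 1\<close> wV w_adj w_red w] by blast
  then show thesis by (rule that)
qed

end

section \<open>Commuting subgroups and subgroups of finite index\<close>

context group
begin

lemma generate_commutes:
  assumes "S \<subseteq> carrier G" "y \<in> carrier G" "\<And>s. s \<in> S \<Longrightarrow> s \<otimes> y = y \<otimes> s" "x \<in> generate G S"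
  shows "x \<otimes> y = y \<otimes> x"
  using assms(4)
proof (induction rule: generate.induct)
  case (inv h)
  then have h: "h \<in> carrier G" "h \<otimes> y = y \<otimes> h" using assms by auto
  have "h \<otimes> (y \<otimes> inv h) = y \<otimes> h \<otimes> inv h"
    using h assms(2) by (simp add: m_assoc[symmetric])
  also have "\<dots> = y" using h(1) assms(2) by (simp add: m_assoc)
  finally have "y \<otimes> inv h = inv h \<otimes> y"
    using h(1) assms(2) inv_solve_left[of "y \<otimes> inv h" h y] by simp
  then show ?case by simp
next
  case (eng g h)
  then show ?case using assms(1,2) generate_in_carrier[OF assms(1)] by (metis m_assoc)
qed (use assms in auto)

text \<open>
  Stated for a generating set \<open>A\<close> and a subgroup \<open>B\<close>, as is convenient
  for adding the factors of a product one by one.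
\<close>

lemma generate_Un_commuting:
  assumes "A \<subseteq> carrier G" "subgroup B G" "\<And>a b. a \<in> A \<Longrightarrow> b \<in> B \<Longrightarrow> a \<otimes> b = b \<otimes> a"
    and "x \<in> generate G (A \<union> B)"
  obtains a b where "a \<in> generate G A" "b \<in> B" "x = a \<otimes> b"
proof -
  interpret B: subgroup B G by fact
  note A = generate_in_carrier[OF assms(1)]
  have "\<exists>a\<in>generate G A. \<exists>b\<in>B. x = a \<otimes> b"
    using assms(4)
  proof (induction rule: generate.induct)
    case one
    show ?case by (intro bexI[of _ \<one>]) (auto intro: generate.one)
  next
    case (incl h)
    then show ?case
    proof
      assume "h \<in> A" then show ?thesis using assms(1)
        by (intro bexI[of _ h] bexI[of _ \<one>]) (auto intro: generate.incl)
    next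
      assume "h \<in> B" then show ?thesis
        by (intro bexI[of _ \<one>] bexI[of _ h]) (auto intro: generate.one)
    qed
  next
    case (inv h)
    then show ?case
    proof
      assume "h \<in> A" then show ?thesis using assms(1)
        by (intro bexI[of _ "inv h"] bexI[of _ \<one>]) (auto intro: generate.inv)
    next
      assume "h \<in> B" then show ?thesis
        by (intro bexI[of _ \<one>] bexI[of _ "inv h"]) (auto intro: generate.one)
    qed
  next
    case (eng g h)
    then obtain a b a' b' where *: "a \<in> generate G A" "b \<in> B" "g = a \<otimes> b"
      "a' \<in> generate G A" "b' \<in> B" "h = a' \<otimes> b'" by blast
    have c: "a \<in> carrier G" "a' \<in> carrier G" "b \<in> carrier G" "b' \<in> carrier G"
      using * A B.subset by auto
    have "a' \<otimes> b = b \<otimes> a'"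
      using generate_commutes[OF assms(1) c(3) _ *(4)] assms(3) *(2) by blast
    have "g \<otimes> h = a \<otimes> (b \<otimes> a') \<otimes> b'" using c * by (simp add: m_assoc)
    also have "\<dots> = (a \<otimes> a') \<otimes> (b \<otimes> b')"
      using c \<open>a' \<otimes> b = b \<otimes> a'\<close>[symmetric] by (simp add: m_assoc)
    finally have "g \<otimes> h = (a \<otimes> a') \<otimes> (b \<otimes> b')" .
    then show ?case
      using generate.eng[OF *(1,4)] B.m_closed[OF *(2,5)] by (intro bexI) assumption
  qed
  then show thesis using that by blast
qed

text \<open>
  Two of the powers of \<open>g\<close> lie in the same coset.
\<close>

lemma power_in_finite_index_subgroup:
  assumes "subgroup H G" "finite (rcosets H)" "g \<in> carrier G"
  obtains n :: nat where "n \<ge> 1" "g [^] n \<in> H"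
proof -
  interpret H: subgroup H G by fact
  have "range (\<lambda>n::nat. H #> g [^] n) \<subseteq> rcosets H"
    using assms(3) H.subset by (auto intro: rcosetsI)
  then have "\<not> inj (\<lambda>n::nat. H #> g [^] n)"
    using assms(2) finite_subset finite_imageD infinite_UNIV_nat by blast
  then obtain i j :: nat where ij: "i < j" "H #> g [^] i = H #> g [^] j"
    unfolding inj_on_def by (metis nat_neq_iff)
  have "g [^] j \<in> H #> g [^] i"
    using rcos_self[OF _ assms(1), of "g [^] j"] assms(3) ij by simp
  then have "g [^] j \<otimes> inv (g [^] i) \<in> H"
    using assms(1,3) H.rcos_module_imp[OF is_group] by simp
  moreover have "g [^] j = g [^] (j - i) \<otimes> g [^] i"
    using ij(1) assms(3) by (simp add: nat_pow_mult)
  ultimately have "g [^] (j - i) \<in> H"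
    using assms(3) by (simp add: m_assoc)
  then show thesis using ij(1) by (intro that[of "j - i"]) auto
qed

end

section \<open>Fixed vertices and invariant lines\<close>

context simplicial_tree_action
begin

lemma closest_points:
  assumes "A \<noteq> {}" "B \<noteq> {}"
  obtains p q where "p \<in> A" "q \<in> B" "\<And>p' q'. p' \<in> A \<Longrightarrow> q' \<in> B \<Longrightarrow> vdist p q \<le> vdist p' q'"
proof -
  obtain a b where "a \<in> A" "b \<in> B" using assms by blast
  then show thesis
    using ex_has_least_nat[of "\<lambda>(p, q). p \<in> A \<and> q \<in> B" "(a, b)" "\<lambda>(p, q). vdist p q"] that by auto
qed

text \<open>
  If \<open>k\<close> rotates about \<open>p\<close> and moves the neighbour \<open>z\<close>,
  then it cannot keep a vertex \<open>w\<close> on the side of \<open>z\<close>, as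
  \<open>\<phi> k w\<close> lies on the side of \<open>\<phi> k z\<close>.
\<close>

lemma rotation_leaves_branch:
  assumes k: "k \<in> carrier G" and kp: "\<phi> k p = p" and z: "adj p z" "\<phi> k z \<noteq> z"
    and w: "w \<in> pverts T" "vdist z w < vdist p w"
  shows "vdist p (\<phi> k w) < vdist z (\<phi> k w)"
proof -
  note V = adj_verts[OF z(1)]
  have "vdist (\<phi> k z) (\<phi> k w) < vdist p (\<phi> k w)"
    using act_vdist[OF k V(2) w(1)] act_vdist[OF k V(1) w(1)] w(2) kp by simp
  moreover have "adj p (\<phi> k z)" using simplicial[OF k z(1)] kp by simp
  ultimately show ?thesis
    using nearer_neighbour_unique[OF z(1), of "\<phi> k z" "\<phi> k w"] act_verts[OF k w(1)] z(2) by fastforce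
qed

text \<open>
  Take fixed vertices \<open>p\<close> of \<open>u\<close> and \<open>q\<close> of
  \<open>v\<close> at minimal distance. If they differ, the geodesic from \<open>p\<close> to
  \<open>\<phi> v p\<close> passes through \<open>q\<close>, because \<open>v\<close> moves the
  first vertex after \<open>q\<close>. Both of its ends are fixed by \<open>u\<close>, hence so is
  \<open>q\<close>.
\<close>

lemma commuting_elliptic_common_fixpoint:
  assumes u: "u \<in> carrier G" and v: "v \<in> carrier G" and comm: "u \<otimes> v = v \<otimes> u"
    and "elliptic u" "elliptic v"
  obtains x where "x \<in> pverts T" "\<phi> u x = x" "\<phi> v x = x"
proof -
  let ?U = "{x \<in> pverts T. \<phi> u x = x}" and ?V = "{x \<in> pverts T. \<phi> v x = x}"
  have ne: "?U \<noteq> {}" "?V \<noteq> {}" using \<open>elliptic u\<close> \<open>elliptic v\<close> by (auto simp: elliptic_def)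
  obtain p q where "p \<in> ?U" "q \<in> ?V"
    and closest: "\<And>p' q'. p' \<in> ?U \<Longrightarrow> q' \<in> ?V \<Longrightarrow> vdist p q \<le> vdist p' q'"
    using closest_points[OF ne] by blast
  then have p: "p \<in> pverts T" "\<phi> u p = p" and q: "q \<in> pverts T" "\<phi> v q = q" by auto
  have min: "vdist p q \<le> vdist p' q'"
    if "p' \<in> pverts T" "\<phi> u p' = p'" "q' \<in> pverts T" "\<phi> v q' = q'" for p' q'
    using closest that by simp
  have "p = q"
  proof (rule ccontr)
    assume "p \<noteq> q"
    then obtain z where z: "adj q z" "Suc (vdist z p) = vdist q p"
      using nearer_neighbour_exists[OF q(1) p(1)] by auto
    have zV: "z \<in> pverts T" using adj_verts[OF z(1)] by simp
    have "\<phi> v z \<noteq> z" using min[OF p zV] z(2) vdist_sym[of p] by force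
    have far: "vdist q p < vdist (\<phi> v z) p"
    proof (rule ccontr)
      assume "\<not> vdist q p < vdist (\<phi> v z) p"
      moreover have "adj q (\<phi> v z)" using simplicial[OF v z(1)] q by simp
      ultimately have "\<phi> v z = z"
        using nearer_neighbour_unique[OF _ z(1) p(1), of "\<phi> v z"] z(2) by linarith
      then show False using \<open>\<phi> v z \<noteq> z\<close> by simp
    qed
    let ?p' = "\<phi> v p"
    have p'V: "?p' \<in> pverts T" by (rule act_verts[OF v p(1)])
    have qp': "vdist q ?p' = vdist q p" using act_vdist[OF v q(1) p(1)] q(2) by simp
    have "adj q (\<phi> v z)" using simplicial[OF v z(1)] q by simp
    then have path: "vdist p ?p' = vdist p q + vdist q ?p'"
      by (rule vdist_concat[OF p(1) p'V _ _ far]) (use act_vdist[OF v zV p(1)] z(2) qp' in simp)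
    have up': "\<phi> u ?p' = ?p'"
      using act_mult[OF u v p(1)] act_mult[OF v u p(1)] comm p(2) by simp
    have "q = \<phi> u q"
    proof (rule geodesic_point_unique[OF p(1) p'V q(1) act_verts[OF u q(1)]])
      show "vdist p (\<phi> u q) = vdist p q" using act_vdist[OF u p(1) q(1)] p(2) by simp
      show "vdist (\<phi> u q) ?p' = vdist q ?p'" using act_vdist[OF u q(1) p'V] up' by simp
    qed (use path in simp)
    then have "vdist p q \<le> vdist q q" using min[of q q] q by simp
    then show False using \<open>p \<noteq> q\<close> vdist_eq_0[OF p(1) q(1)] by simp
  qed
  then show thesis using p q that by blast
qed

text \<open>
  Serre's lemma, by induction on the number of generators. Let \<open>p\<close> be fixed by
  \<open>S\<close> and \<open>q\<close> by \<open>s\<close>, at minimal distance. If they differ,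
  some \<open>k\<close> in \<open>S\<close> moves the first vertex \<open>p'\<close> after
  \<open>p\<close> on the geodesic from \<open>p\<close> to \<open>q\<close>, and \<open>s\<close>
  moves its last but one vertex \<open>q'\<close>. Let \<open>y\<close> be fixed by the product of
  \<open>s\<close> and \<open>k\<close>, and \<open>z = \<phi> k y\<close>. Because
  \<open>k\<close> moves \<open>p'\<close>, one of \<open>y\<close> and \<open>z\<close> is
  separated from \<open>q\<close> by \<open>p\<close>; because \<open>s\<close> moves
  \<open>q'\<close>, one of them is separated from \<open>p\<close> by \<open>q\<close>. As
  \<open>y\<close> and \<open>z\<close> are equally far from \<open>p\<close>, and equally far
  from \<open>q\<close>, these are incompatible.
\<close>

lemma generators_common_fixpoint:
  assumes "finite S" "S \<subseteq> carrier G" "\<And>g. g \<in> generate G S \<Longrightarrow> elliptic g"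
  shows "\<exists>x\<in>pverts T. \<forall>s\<in>S. \<phi> s x = x"
  using assms
proof (induction S rule: finite_induct)
  case empty
  then show ?case using connected by (auto simp: strongly_connected_def)
next
  case (insert s S)
  have s: "s \<in> carrier G" and S: "S \<subseteq> carrier G" using insert.prems by auto
  have "generate G S \<subseteq> generate G (insert s S)" by (rule G.mono_generate) auto
  then have fixS: "\<exists>x\<in>pverts T. \<forall>k\<in>S. \<phi> k x = x" using insert by blast
  have "elliptic s"
    using insert.prems(2)[of s] by (auto intro: generate.incl)
  let ?P = "{x \<in> pverts T. \<forall>k\<in>S. \<phi> k x = x}" and ?Q = "{x \<in> pverts T. \<phi> s x = x}"
  have ne: "?P \<noteq> {}" "?Q \<noteq> {}" using fixS \<open>elliptic s\<close> by (auto simp: elliptic_def)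
  obtain p q where "p \<in> ?P" "q \<in> ?Q"
    and closest: "\<And>p' q'. p' \<in> ?P \<Longrightarrow> q' \<in> ?Q \<Longrightarrow> vdist p q \<le> vdist p' q'"
    using closest_points[OF ne] by blast
  then have p: "p \<in> pverts T" "\<And>k. k \<in> S \<Longrightarrow> \<phi> k p = p" and q: "q \<in> pverts T" "\<phi> s q = q"
    by auto
  have min: "vdist p q \<le> vdist p' q'"
    if "p' \<in> pverts T" "\<forall>k\<in>S. \<phi> k p' = p'" "q' \<in> pverts T" "\<phi> s q' = q'" for p' q'
    using closest that by simp
  have "p = q"
  proof (rule ccontr)
    assume "p \<noteq> q"
    obtain p' where p': "adj p p'" "Suc (vdist p' q) = vdist p q"
      using nearer_neighbour_exists[OF p(1) q(1) \<open>p \<noteq> q\<close>] .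
    obtain q' where q': "adj q q'" "Suc (vdist q' p) = vdist q p"
      using nearer_neighbour_exists[OF q(1) p(1)] \<open>p \<noteq> q\<close> by auto
    have V: "p' \<in> pverts T" "q' \<in> pverts T" using adj_verts p'(1) q'(1) by auto
    have "\<not> (\<forall>k\<in>S. \<phi> k p' = p')" using min[OF V(1) _ q] p'(2) by auto
    then obtain k where k: "k \<in> S" "\<phi> k p' \<noteq> p'" by blast
    have kG: "k \<in> carrier G" using k S by auto
    have sq': "\<phi> s q' \<noteq> q'" using min[OF p(1) _ V(2)] p(2) q'(2) vdist_sym[of p] by force
    have "s \<otimes> k \<in> generate G (insert s S)" using k(1) by (intro generate.eng generate.incl) auto
    then obtain y where y: "y \<in> pverts T" "\<phi> (s \<otimes> k) y = y"
      using insert.prems(2) by (auto simp: elliptic_def)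
    define z where "z = \<phi> k y"
    have z: "z \<in> pverts T" "\<phi> s z = y" using y kG s by (simp_all add: z_def act_verts act_mult)
    have yz: "vdist y p = vdist z p" "vdist y q = vdist z q"
      using act_vdist[OF kG y(1) p(1)] p(2)[OF k(1)] act_vdist[OF s z(1) q(1)] q(2) z by (simp_all add: z_def)
    have away_p: "vdist w q = vdist w p + vdist p q"
      if "w \<in> pverts T" "\<not> vdist p' w < vdist p w" for w
      using vdist_concat[OF that(1) q(1) p'(1)] vdist_adj_neq[OF p'(1) that(1)] that(2) p'(2) by linarith
    have away_q: "vdist w p = vdist w q + vdist p q"
      if "w \<in> pverts T" "\<not> vdist q' w < vdist q w" for w
      using vdist_concat[OF that(1) p(1) q'(1)] vdist_adj_neq[OF q'(1) that(1)] that(2) q'(2) vdist_sym[of p q]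
      by linarith
    have "\<not> vdist p' y < vdist p y \<or> \<not> vdist p' z < vdist p z"
      using rotation_leaves_branch[OF kG p(2)[OF k(1)] p'(1) k(2) y(1)] by (auto simp: z_def)
    then have "vdist y q = vdist y p + vdist p q"
      using away_p[OF y(1)] away_p[OF z(1)] yz by linarith
    moreover have "\<not> vdist q' y < vdist q y \<or> \<not> vdist q' z < vdist q z"
      using rotation_leaves_branch[OF s q(2) q'(1) sq' z(1)] z(2) by auto
    then have "vdist y p = vdist y q + vdist p q"
      using away_q[OF y(1)] away_q[OF z(1)] yz by linarith
    ultimately show False using vdist_eq_0[OF p(1) q(1)] \<open>p \<noteq> q\<close> by simp
  qed
  then show ?case using p q by auto
qed

lemma finitely_generated_elliptic_fixpoint:
  assumes "finitely_generated_group G" "\<And>g. g \<in> carrier G \<Longrightarrow> elliptic g"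
  shows "fixed_vertices T G \<phi> \<noteq> {}"
proof -
  obtain S where S: "finite S" "S \<subseteq> carrier G" "generate G S = carrier G"
    using assms(1) by (auto simp: finitely_generated_group_def)
  then obtain x where x: "x \<in> pverts T" "\<forall>s\<in>S. \<phi> s x = x"
    using generators_common_fixpoint assms(2) by metis
  have "generate G S \<subseteq> stabilizer G \<phi> x"
    using x S(2) by (intro G.generate_subgroup_incl stabilizer_subgroup) (auto simp: stabilizer_def)
  then show ?thesis using x S(3) by (auto simp: fixed_vertices_def stabilizer_def)
qed

text \<open>
  The \<open>n\<close>-th power of the translation of the axis by \<open>c\<close> is the
  translation by \<open>n * c\<close>, and \<open>n * c \<noteq> 0\<close>.
\<close>

lemma hyperbolic_power:
  assumes g: "g \<in> carrier G" and "\<not> elliptic g" "n \<ge> 1"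
  shows "\<not> elliptic (g [^] (n::nat))"
proof -
  obtain a where a: "line a" "\<phi> g ` range a \<subseteq> range a"
    using hyperbolic_has_axis[OF assms(1,2)] by blast
  obtain c where c: "c \<noteq> 0" "\<And>i. \<phi> g (a i) = a (i + c)"
    using hyperbolic_translates_line[OF g a assms(2)] by blast
  have "\<phi> (g [^] n) (a i) = a (i + int n * c)" for n i
  proof (induction n arbitrary: i)
    case 0 then show ?case using act_one line_verts[OF a(1)] by simp
  next
    case (Suc n)
    then show ?case using act_mult[OF _ g line_verts[OF a(1)], of "g [^] n" i] c g
      by (simp add: algebra_simps)
  qed
  then show ?thesis
    using translation_not_elliptic[of "g [^] n" a "int n * c"] g a c \<open>n \<ge> 1\<close> by simp
qed

text \<open>
  The factors are added one at a time: an element of the larger product is the product of two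
  commuting elliptic elements.
\<close>

lemma generate_commuting_elliptic:
  assumes "finite J" "\<And>j. j \<in> J \<Longrightarrow> subgroup (H j) G"
    and "\<And>i j x y. \<lbrakk>i \<in> J; j \<in> J; i \<noteq> j; x \<in> H i; y \<in> H j\<rbrakk> \<Longrightarrow> x \<otimes> y = y \<otimes> x"
    and "\<And>j x. j \<in> J \<Longrightarrow> x \<in> H j \<Longrightarrow> elliptic x"
    and "g \<in> generate G (\<Union>j\<in>J. H j)"
  shows "elliptic g"
  using assms
proof (induction J arbitrary: g rule: finite_induct)
  case empty
  then have "g = \<one>" using G.generate_empty by simp
  then show ?case using connected act_one by (auto simp: elliptic_def strongly_connected_def)
next
  case (insert j J)
  let ?A = "\<Union>i\<in>J. H i"
  have A: "?A \<subseteq> carrier G" using insert.prems(1) subgroup.subset by blast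
  have "g \<in> generate G (?A \<union> H j)" using insert.prems(4) by (simp add: Un_commute)
  then obtain x y where xy: "x \<in> generate G ?A" "y \<in> H j" "g = x \<otimes> y"
    using G.generate_Un_commuting[OF A, of "H j"] insert.prems(1,2) insert.hyps(2) by blast
  have xG: "x \<in> carrier G" and yG: "y \<in> carrier G"
    using xy insert.prems(1) G.generate_in_carrier[OF A] subgroup.mem_carrier by fastforce+
  have "elliptic x"
  proof (rule insert.IH)
    show "subgroup (H i) G" if "i \<in> J" for i using insert.prems(1) that by simp
    show "y \<otimes> z = z \<otimes> y" if "i \<in> J" "k \<in> J" "i \<noteq> k" "y \<in> H i" "z \<in> H k" for i k y z
      using insert.prems(2)[of i k] that by simp
    show "elliptic z" if "i \<in> J" "z \<in> H i" for i z using insert.prems(3)[of i] that by simp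
  qed (rule xy(1))
  moreover have "elliptic y" using insert.prems(3) xy by auto
  moreover have "x \<otimes> y = y \<otimes> x"
    by (rule G.generate_commutes[OF A yG _ xy(1)]) (use insert.prems(2) insert.hyps(2) xy(2) in blast)
  ultimately obtain v where v: "v \<in> pverts T" "\<phi> x v = v" "\<phi> y v = v"
    using commuting_elliptic_common_fixpoint[OF xG yG] by blast
  then have "\<phi> g v = v" using xy(3) act_mult[OF xG yG v(1)] by simp
  then show ?case using v(1) by (auto simp: elliptic_def)
qed

lemma act_axis_commuting:
  assumes "u \<in> carrier G" "g \<in> carrier G" "u \<otimes> g = g \<otimes> u"
  shows "\<phi> u ` axis g \<subseteq> axis g"
  using act_axis[OF assms(1,2)] assms by (simp add: G.m_assoc)

text \<open>
  The line is the common axis of hyperbolic elements \<open>w\<close> and \<open>w'\<close> of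
  \<open>H i\<close> and \<open>H j\<close>: as these commute, each preserves the axis of the
  other. The elements of \<open>H i\<close> commute with \<open>w'\<close>, and those of the other
  subgroups with \<open>w\<close>, so \<open>R\<close> preserves the line. For any
  \<open>g\<close> in the group, the conjugate of \<open>w\<close> by \<open>g\<close> is a
  hyperbolic element of \<open>R\<close>; its axis, which is the image of the line under
  \<open>g\<close>, is therefore the line itself.
\<close>

lemma invariant_line_of_commuting_conjugates:
  assumes R: "R \<lhd> G" "finite (rcosets R)" "R = generate G (\<Union>j\<in>J. H j)"
    and "finite J" and ij: "i \<in> J" "j \<in> J" "i \<noteq> j"
    and sub: "\<And>j. j \<in> J \<Longrightarrow> subgroup (H j) G"
    and comm: "\<And>i j x y. \<lbrakk>i \<in> J; j \<in> J; i \<noteq> j; x \<in> H i; y \<in> H j\<rbrakk> \<Longrightarrow> x \<otimes> y = y \<otimes> x"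
    and conj: "\<And>i j. \<lbrakk>i \<in> J; j \<in> J\<rbrakk> \<Longrightarrow> \<exists>g\<in>carrier G. \<forall>x\<in>H i. g \<otimes> x \<otimes> inv g \<in> H j"
    and h: "h \<in> carrier G" "\<not> elliptic h"
  obtains a w where "line a" "\<And>g. g \<in> carrier G \<Longrightarrow> \<phi> g ` range a \<subseteq> range a"
    "w \<in> carrier G" "\<not> elliptic w"
proof -
  interpret R: normal R G by fact
  have HG: "x \<in> carrier G" if "j \<in> J" "x \<in> H j" for j x
    using sub that subgroup.mem_carrier by fast
  obtain n :: nat where "n \<ge> 1" "h [^] n \<in> R"
    using G.power_in_finite_index_subgroup[OF R.subgroup_axioms R(2) h(1)] .
  then have "h [^] n \<in> generate G (\<Union>j\<in>J. H j)" "\<not> elliptic (h [^] n)"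
    using R(3) hyperbolic_power[OF h] by simp_all
  moreover have "elliptic (h [^] n)"
    if "h [^] n \<in> generate G (\<Union>j\<in>J. H j)" "\<forall>m\<in>J. \<forall>v\<in>H m. elliptic v"
  proof (rule generate_commuting_elliptic[of J H])
    show "x \<otimes> y = y \<otimes> x" if "i \<in> J" "j \<in> J" "i \<noteq> j" "x \<in> H i" "y \<in> H j" for i j x y
      by (rule comm) fact+
  qed (use that sub \<open>finite J\<close> in auto)
  ultimately obtain m v where v: "m \<in> J" "v \<in> H m" "\<not> elliptic v" by blast
  have hyp: "\<exists>w\<in>H j. \<not> elliptic w" if "j \<in> J" for j
    using conj[OF v(1) that] v elliptic_conj HG by blast
  obtain w where w: "w \<in> H i" "\<not> elliptic w" using hyp ij by blast
  obtain w' where w': "w' \<in> H j" "\<not> elliptic w'" using hyp ij by blast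
  note wG = HG[OF ij(1) w(1)] HG[OF ij(2) w'(1)]
  obtain a where a: "line a" "\<phi> w ` range a \<subseteq> range a"
    using hyperbolic_has_axis[OF wG(1) w(2)] by blast
  have aw: "range a = axis w" by (rule invariant_line_eq_axis[OF wG(1) a w(2)])
  have "\<phi> w' ` range a \<subseteq> range a"
    unfolding aw by (rule act_axis_commuting[OF wG(2) wG(1) comm[OF ij(2,1) ij(3)[symmetric] w'(1) w(1)]])
  then have aw': "range a = axis w'" by (rule invariant_line_eq_axis[OF wG(2) a(1) _ w'(2)])
  have H_inv: "\<phi> x ` range a \<subseteq> range a" if "m \<in> J" "x \<in> H m" for m x
  proof (cases "m = i")
    case True
    then have "m \<noteq> j" using ij(3) by simp
    then show ?thesis
      unfolding aw' using act_axis_commuting[OF HG[OF that] wG(2)] comm[OF that(1) ij(2) _ that(2) w'(1)] by blast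
  next
    case False
    then show ?thesis
      unfolding aw using act_axis_commuting[OF HG[OF that] wG(1)] comm[OF that(1) ij(1) _ that(2) w(1)] by blast
  qed
  have UG: "(\<Union>j\<in>J. H j) \<subseteq> carrier G" using HG by blast
  have R_inv: "\<phi> r ` range a \<subseteq> range a" if "r \<in> R" for r
    using that unfolding R(3)
  proof (induction rule: generate.induct)
    case one
    then show ?case using act_one line_verts[OF a(1)] by auto
  next
    case (incl h)
    then show ?case using H_inv by blast
  next
    case (inv h)
    then obtain m where "m \<in> J" "h \<in> H m" by blast
    then show ?case using H_inv[of m "inv h"] subgroup.m_inv_closed[OF sub] by simp
  next
    case (eng g h)
    then have "g \<in> carrier G" "h \<in> carrier G" using G.generate_in_carrier[OF UG] by blast+
    then have "\<phi> (g \<otimes> h) x = \<phi> g (\<phi> h x)" if "x \<in> range a" for x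
      using act_mult line_verts[OF a(1)] that by auto
    then have "\<phi> (g \<otimes> h) ` range a = \<phi> g ` (\<phi> h ` range a)"
      by (simp add: image_image cong: image_cong)
    also have "\<dots> \<subseteq> \<phi> g ` range a" by (rule image_mono) (rule eng.IH)
    finally show ?case using eng.IH(1) by (rule subset_trans)
  qed
  have "\<phi> g ` range a \<subseteq> range a" if g: "g \<in> carrier G" for g
  proof -
    have "w \<in> R" unfolding R(3) using ij w by (blast intro: generate.incl)
    then have cR: "g \<otimes> w \<otimes> inv g \<in> R" using R.inv_op_closed2[OF g] by simp
    then have "range a = axis (g \<otimes> w \<otimes> inv g)"
      using invariant_line_eq_axis[OF _ a(1) R_inv] elliptic_conj[OF g wG(1)] w(2) R.mem_carrier by blast
    then show ?thesis using act_axis[OF g wG(1)] aw by simp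
  qed
  then show thesis using that a(1) wG(1) w(2) by blast
qed

end

section \<open>Homomorphisms to the infinite dihedral group\<close>

lemma subgroup_of_int_cyclic:
  fixes S :: "int set"
  assumes diff: "\<And>x y. x \<in> S \<Longrightarrow> y \<in> S \<Longrightarrow> x - y \<in> S" and "c \<in> S" "c \<noteq> 0"
  obtains m where "m > 0" "\<And>x. x \<in> S \<longleftrightarrow> m dvd x"
proof -
  have zero: "0 \<in> S" using diff[OF \<open>c \<in> S\<close> \<open>c \<in> S\<close>] by simp
  have neg: "- x \<in> S" if "x \<in> S" for x using diff[OF zero that] by simp
  have add: "x + y \<in> S" if "x \<in> S" "y \<in> S" for x y using diff[OF that(1) neg[OF that(2)]] by simp
  have nat_mult: "int n * x \<in> S" if "x \<in> S" for n x
    by (induction n) (use that zero add in \<open>auto simp: algebra_simps\<close>)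
  have mult: "k * x \<in> S" if "x \<in> S" for k x
    using nat_mult[OF that, of "nat k"] neg[OF nat_mult[OF that, of "nat (- k)"]]
    by (cases "k \<ge> 0") auto
  have "\<exists>n>0. int n \<in> S"
    using \<open>c \<in> S\<close> neg[OF \<open>c \<in> S\<close>] \<open>c \<noteq> 0\<close> by (intro exI[of _ "nat \<bar>c\<bar>"]) (auto simp: abs_if)
  then obtain n where n: "n > 0" "int n \<in> S" and least: "\<And>n'. n' > 0 \<Longrightarrow> int n' \<in> S \<Longrightarrow> n \<le> n'"
    using exists_least_iff[of "\<lambda>n. n > 0 \<and> int n \<in> S"] by (metis not_le)
  have "x \<in> S \<longleftrightarrow> int n dvd x" for x
  proof
    assume "x \<in> S"
    then have "x mod int n \<in> S"
      using diff[OF \<open>x \<in> S\<close> mult[OF n(2), of "x div int n"]] by (simp add: minus_div_mult_eq_mod)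
    moreover have "0 \<le> x mod int n" "x mod int n < int n" using n(1) by simp_all
    ultimately have "x mod int n = 0"
      using least[of "nat (x mod int n)"] by (cases "x mod int n = 0") auto
    then show "int n dvd x" by auto
  next
    assume "int n dvd x"
    then show "x \<in> S" using mult[OF n(2)] by (auto simp: mult.commute elim!: dvdE)
  qed
  then show thesis using n(1) that[of "int n"] by simp
qed

text \<open>
  The faithful action of the infinite dihedral group on the integers, through which its elements
  are recognized below.
\<close>

definition dihedral_act :: "int \<times> bool \<Rightarrow> int \<Rightarrow> int" where
  "dihedral_act x i = fst x + (if snd x then - i else i)"

lemma dihedral_mult:
  "x \<otimes>\<^bsub>infinite_dihedral_group\<^esub> y = (fst x + (if snd x then - fst y else fst y), snd x \<noteq> snd y)"
  by (simp add: infinite_dihedral_group_def split: prod.splits)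

lemma carrier_dihedral [simp]: "carrier infinite_dihedral_group = UNIV"
  by (simp add: infinite_dihedral_group_def)

lemma dihedral_act_mult:
  "dihedral_act (x \<otimes>\<^bsub>infinite_dihedral_group\<^esub> y) i = dihedral_act x (dihedral_act y i)"
  by (simp add: dihedral_mult dihedral_act_def)

lemma dihedral_act_faithful:
  assumes "\<And>i. dihedral_act x i = dihedral_act y i"
  shows "x = y"
  using assms[of 0] assms[of 1] by (auto simp: dihedral_act_def prod_eq_iff split: if_splits)

text \<open>
  The translations in the image of \<open>f\<close> form the multiples of some
  \<open>m > 0\<close>. If the image contains nothing else, it is isomorphic to the integers.
  Otherwise it contains some reflection \<open>(r, True)\<close>; taking this reflection for the
  basic one and \<open>m\<close> for the unit length identifies it with the whole dihedral group.
\<close>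

lemma dihedral_hom_epi:
  assumes f: "f \<in> hom G infinite_dihedral_group" and w: "w \<in> carrier G" "f w = (c, False)" "c \<noteq> 0"
    and "group G"
  shows "(\<exists>h. h \<in> epi G integer_group) \<or> (\<exists>h. h \<in> epi G infinite_dihedral_group)"
proof -
  interpret G: group G by fact
  interpret f: group_hom G infinite_dihedral_group f
    using f \<open>group G\<close> group_infinite_dihedral_group by (simp add: group_hom_def group_hom_axioms_def)
  have f_mult: "f (x \<otimes>\<^bsub>G\<^esub> y) = (fst (f x) + (if snd (f x) then - fst (f y) else fst (f y)), snd (f x) \<noteq> snd (f y))"
    if "x \<in> carrier G" "y \<in> carrier G" for x y
    using that by (simp add: dihedral_mult)
  have f_inv: "f (inv\<^bsub>G\<^esub> x) = (- fst (f x), False)" if "x \<in> carrier G" "\<not> snd (f x)" for x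
  proof -
    have "f (inv\<^bsub>G\<^esub> x \<otimes>\<^bsub>G\<^esub> x) = (0, False)" using that by (simp add: infinite_dihedral_group_def)
    then show ?thesis using f_mult[of "inv\<^bsub>G\<^esub> x" x] that by (auto simp: prod_eq_iff)
  qed
  define S where "S = {c. \<exists>g\<in>carrier G. f g = (c, False)}"
  have diff: "x - y \<in> S" if "x \<in> S" "y \<in> S" for x y
  proof -
    obtain g h where gh: "g \<in> carrier G" "f g = (x, False)" "h \<in> carrier G" "f h = (y, False)"
      using \<open>x \<in> S\<close> \<open>y \<in> S\<close> by (auto simp: S_def)
    then have "f (g \<otimes>\<^bsub>G\<^esub> inv\<^bsub>G\<^esub> h) = (x - y, False)" by (simp add: f_mult f_inv del: f.hom_mult f.hom_inv)
    then show ?thesis using gh(1,3) unfolding S_def by blast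
  qed
  have "c \<in> S" using w by (auto simp: S_def)
  then obtain m where m: "m > 0" "\<And>x. x \<in> S \<longleftrightarrow> m dvd x"
    using subgroup_of_int_cyclic[OF diff _ \<open>c \<noteq> 0\<close>] by blast
  show ?thesis
  proof (cases "\<exists>g\<in>carrier G. snd (f g)")
    case False
    define h where "h g = fst (f g) div m" for g
    have dvd: "m dvd fst (f g)" if "g \<in> carrier G" for g
    proof -
      have "f g = (fst (f g), False)" using False that by (simp add: prod_eq_iff)
      then have "fst (f g) \<in> S" using that unfolding S_def by blast
      then show ?thesis by (simp add: m(2))
    qed
    have "h \<in> hom G integer_group"
      using False dvd by (intro homI) (simp_all add: h_def f_mult div_plus_div_distrib_dvd_left del: f.hom_mult)
    moreover have "n \<in> h ` carrier G" for n
    proof -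
      have "n * m \<in> S" using m(2) by simp
      then obtain g where g: "g \<in> carrier G" "f g = (n * m, False)" by (auto simp: S_def)
      then have "h g = n" using m(1) by (simp add: h_def)
      then show ?thesis using g(1) by blast
    qed
    ultimately have "h \<in> epi G integer_group" unfolding epi_def by auto
    then show ?thesis by blast
  next
    case True
    then obtain \<rho> r where \<rho>: "\<rho> \<in> carrier G" "f \<rho> = (r, True)" by (metis prod.collapse)
    define base where "base g = fst (f g) - (if snd (f g) then r else 0)" for g
    define h where "h g = (base g div m, snd (f g))" for g
    have dvd: "m dvd base g" if "g \<in> carrier G" for g
    proof (cases "snd (f g)")
      case True
      then have "f (g \<otimes>\<^bsub>G\<^esub> \<rho>) = (base g, False)" using that \<rho> by (simp add: f_mult base_def del: f.hom_mult)
      then have "base g \<in> S" using that \<rho>(1) unfolding S_def by blast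
      then show ?thesis by (simp add: m(2))
    next
      case False
      then have "f g = (base g, False)" by (simp add: base_def prod_eq_iff)
      then have "base g \<in> S" using that unfolding S_def by blast
      then show ?thesis by (simp add: m(2))
    qed
    have "h (x \<otimes>\<^bsub>G\<^esub> y) = h x \<otimes>\<^bsub>infinite_dihedral_group\<^esub> h y" if xy: "x \<in> carrier G" "y \<in> carrier G" for x y
    proof -
      have "base (x \<otimes>\<^bsub>G\<^esub> y) = base x + (if snd (f x) then - base y else base y)"
        using xy by (simp add: base_def f_mult del: f.hom_mult)
      moreover obtain p q where "base x = m * p" "base y = m * q"
        using dvd[OF xy(1)] dvd[OF xy(2)] by (auto elim!: dvdE)
      ultimately have "base (x \<otimes>\<^bsub>G\<^esub> y) = m * (p + (if snd (f x) then - q else q))" "base x div m = p" "base y div m = q"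
        using m(1) by (auto simp: algebra_simps)
      then show ?thesis using xy m(1) by (simp add: h_def dihedral_mult f_mult del: f.hom_mult)
    qed
    then have "h \<in> hom G infinite_dihedral_group" by (intro homI) simp_all
    moreover have "(n, s) \<in> h ` carrier G" for n s
    proof -
      have "m * n \<in> S" using m(2) by simp
      then obtain g where g: "g \<in> carrier G" "f g = (m * n, False)" by (auto simp: S_def)
      show ?thesis
      proof (cases s)
        case True
        have "f (g \<otimes>\<^bsub>G\<^esub> \<rho>) = (m * n + r, True)" using g \<rho> by (simp add: f_mult del: f.hom_mult)
        then have "h (g \<otimes>\<^bsub>G\<^esub> \<rho>) = (n, s)" using True m(1) by (simp add: h_def base_def)
        then show ?thesis using g(1) \<rho>(1) by (metis G.m_closed image_eqI)
      next
        case False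
        then have "h g = (n, s)" using g(2) m(1) by (simp add: h_def base_def)
        then show ?thesis using g(1) by (metis image_eqI)
      qed
    qed
    ultimately have "h \<in> epi G infinite_dihedral_group" unfolding epi_def by auto
    then show ?thesis by blast
  qed
qed

lemma (in simplicial_tree_action) line_hom_dihedral:
  assumes a: "line a" "\<And>g. g \<in> carrier G \<Longrightarrow> \<phi> g ` range a \<subseteq> range a"
    and w: "w \<in> carrier G" "\<not> elliptic w"
  obtains f c where "f \<in> hom G infinite_dihedral_group" "f w = (c, False)" "c \<noteq> 0"
proof -
  have "\<exists>x. \<forall>i. \<phi> g (a i) = a (dihedral_act x i)" if "g \<in> carrier G" for g
    using act_on_line[OF that a(1) a(2)[OF that]] by (metis dihedral_act_def fst_conv snd_conv)
  then obtain f where f: "\<And>g i. g \<in> carrier G \<Longrightarrow> \<phi> g (a i) = a (dihedral_act (f g) i)"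
    by metis
  have fI: "f g = x" if "g \<in> carrier G" "\<And>i. \<phi> g (a i) = a (dihedral_act x i)" for g x
    using that line_inj[OF a(1)] f by (intro dihedral_act_faithful) metis
  have "f \<in> hom G infinite_dihedral_group"
  proof (rule homI)
    fix g h assume gh: "g \<in> carrier G" "h \<in> carrier G"
    show "f (g \<otimes> h) = f g \<otimes>\<^bsub>infinite_dihedral_group\<^esub> f h"
    proof (rule fI)
      show "\<phi> (g \<otimes> h) (a i) = a (dihedral_act (f g \<otimes>\<^bsub>infinite_dihedral_group\<^esub> f h) i)" for i
        using act_mult[OF gh line_verts[OF a(1)]] f[OF gh(1)] f[OF gh(2)] by (simp add: dihedral_act_mult)
    qed (use gh in simp)
  qed simp
  moreover obtain c where c: "c \<noteq> 0" "\<And>i. \<phi> w (a i) = a (i + c)"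
    using hyperbolic_translates_line[OF w(1) a(1) a(2)[OF w(1)] w(2)] by blast
  moreover have "f w = (c, False)"
    using c w(1) by (intro fI) (simp_all add: dihedral_act_def add.commute)
  ultimately show thesis using that by blast
qed

section \<open>Groups with a dihedral translation act on a line\<close>

definition integer_line :: "(int \<Rightarrow> 'v) \<Rightarrow> 'v pair_pre_digraph" where
  "integer_line \<iota> = \<lparr>pverts = range \<iota>, parcs = {(\<iota> i, \<iota> j) |i j. \<bar>i - j\<bar> = 1}\<rparr>"

lemma pcas_nth:
  "pcas u p v \<Longrightarrow> i < length p \<Longrightarrow> p ! i = (pawalk_verts u p ! i, pawalk_verts u p ! Suc i)"
proof (induction p arbitrary: u i)
  case (Cons e p)
  have hd: "pawalk_verts x q ! 0 = x" if "pcas x q v" for x q using that by (cases q) auto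
  show ?case using Cons hd by (cases i) (auto simp: prod_eq_iff)
qed simp

lemma pcas_ends:
  "pcas u p v \<Longrightarrow> pawalk_verts u p ! 0 = u \<and> pawalk_verts u p ! length p = v \<and> length (pawalk_verts u p) = Suc (length p)"
  by (induction p arbitrary: u) auto

text \<open>
  On a closed walk of length at least 3 with no repeated vertex apart from its ends, steps in
  opposite directions cannot follow each other, so the position changes linearly, and the walk
  does not close up.
\<close>

lemma simplicial_tree_integer_line:
  assumes "inj \<iota>"
  shows "simplicial_tree (integer_line \<iota>)"
proof -
  let ?T = "integer_line \<iota>"
  have arc: "(\<iota> i, \<iota> j) \<in> parcs ?T \<longleftrightarrow> \<bar>i - j\<bar> = 1" for i j
    using \<open>inj \<iota>\<close> by (auto simp: integer_line_def inj_eq)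
  interpret pair_bidirected_digraph ?T
  proof
    show "symmetric (with_proj ?T)"
      by (auto simp: symmetric_def sym_def integer_line_def) (metis abs_minus_commute)
  qed (use \<open>inj \<iota>\<close> in \<open>auto simp: integer_line_def inj_eq\<close>)
  have "\<iota> i \<rightarrow>\<^sup>*\<^bsub>?T\<^esub> \<iota> (i + int n)" for i n
  proof (induction n)
    case 0
    have "\<iota> i \<in> pverts ?T" by (simp add: integer_line_def)
    then show ?case by simp
  next
    case (Suc n)
    have "(\<iota> (i + int n), \<iota> (i + int (Suc n))) \<in> parcs ?T" by (simp add: arc)
    then show ?case using Suc reachable_adj_trans[of "\<iota> i" "\<iota> (i + int n)"] by simp
  qed
  then have "\<iota> i \<rightarrow>\<^sup>*\<^bsub>?T\<^esub> \<iota> j" if "i \<le> j" for i j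
    using zle_iff_zadd[of i j] that by auto
  then have "\<iota> i \<rightarrow>\<^sup>*\<^bsub>?T\<^esub> \<iota> j" for i j
    using symmetric_reachable[OF sym_arcs] by (metis linear)
  then have conn: "strongly_connected (with_proj ?T)"
    by (auto simp: strongly_connected_def integer_line_def)
  have "length p \<le> 2" if "cycle p" for p
  proof (rule ccontr)
    assume "\<not> length p \<le> 2"
    define n where "n = length p"
    have n: "n \<ge> 3" using \<open>\<not> length p \<le> 2\<close> by (simp add: n_def)
    obtain u where u: "awalk u p u" "distinct (tl (pawalk_verts u p))"
      using \<open>cycle p\<close> by (auto simp: cycle_def)
    then have cas: "pcas u p u" and arcs: "set p \<subseteq> parcs ?T" by (auto simp: awalk_def)
    define v where "v i = pawalk_verts u p ! i" for i
    have arc_v: "(v i, v (Suc i)) \<in> parcs ?T" if "i < n" for i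
      using pcas_nth[OF cas, of i] arcs nth_mem[of i p] that by (auto simp: v_def n_def)
    have "\<forall>i. \<exists>x. i \<le> n \<longrightarrow> v i = \<iota> x"
    proof (intro allI)
      fix i
      show "\<exists>x. i \<le> n \<longrightarrow> v i = \<iota> x"
        using arc_v[of i] arc_v[of "i - 1"] n by (cases "i < n") (auto simp: integer_line_def)
    qed
    then obtain x where x: "\<And>i. i \<le> n \<Longrightarrow> v i = \<iota> (x i)" by metis
    have step: "\<bar>x i - x (Suc i)\<bar> = 1" if "i < n" for i
      using arc_v[OF that] that by (simp add: x arc)
    have closed: "v 0 = v n" using pcas_ends[OF cas] by (simp add: v_def n_def)
    have dist: "v i \<noteq> v j" if "1 \<le> i" "i < j" "j \<le> n" for i j
    proof -
      have "tl (pawalk_verts u p) ! (i - 1) \<noteq> tl (pawalk_verts u p) ! (j - 1)"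
        using that u(2) pcas_ends[OF cas] by (subst nth_eq_iff_index_eq) (auto simp: n_def)
      then show ?thesis using that pcas_ends[OF cas] by (simp add: v_def nth_tl n_def)
    qed
    have turn: "x i \<noteq> x (Suc (Suc i))" if "Suc (Suc i) \<le> n" for i
    proof (cases "i = 0")
      case True
      have "v 2 \<noteq> v n" using dist[of 2 n] n by simp
      then show ?thesis using True closed that x[of 0] x[of 2] by (auto simp: numeral_2_eq_2)
    next
      case False
      then show ?thesis using dist[of i "Suc (Suc i)"] that x[of i] x[of "Suc (Suc i)"] by auto
    qed
    have lin: "i \<le> n \<Longrightarrow> x i = x 0 + int i * (x 1 - x 0)" for i
    proof (induction i rule: induct_nat_012)
      case (ge2 i)
      have "x (Suc (Suc i)) = x (Suc i) + (x (Suc i) - x i)"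
        using step[of i] step[of "Suc i"] turn[of i] ge2.prems by linarith
      then show ?case using ge2 by (simp add: algebra_simps)
    qed simp_all
    have "x 0 = x n" using closed x[of 0] x[of n] \<open>inj \<iota>\<close> by (simp add: inj_eq)
    then have "x 1 = x 0" using lin[of n] n by simp
    then show False using step[of 0] n by simp
  qed
  then show ?thesis
    by (intro simplicial_tree.intro simplicial_tree_axioms.intro pair_bidirected_digraph_axioms conn)
qed

text \<open>
  The group acts on the line through \<open>f\<close> and \<open>dihedral_act\<close>. The first
  component is doubled, which amounts to passing to the barycentric subdivision: a reflection then
  fixes a vertex instead of possibly inverting an edge. The line is embedded in \<open>'v\<close>
  as a countable subset.
\<close>

lemma translation_hom_not_FA:
  fixes G :: "('a, 'b) monoid_scheme"
  assumes f: "f \<in> hom G infinite_dihedral_group" and w: "w \<in> carrier G" "f w = (c, False)" "c \<noteq> 0"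
    and "group G" and "infinite (UNIV :: 'v set)"
  shows "\<not> property_FA TYPE('v) G"
proof -
  interpret G: group G by fact
  interpret f: group_hom G infinite_dihedral_group f
    using f \<open>group G\<close> group_infinite_dihedral_group by (simp add: group_hom_def group_hom_axioms_def)
  obtain e :: "nat \<Rightarrow> 'v" where "inj e" using infinite_countable_subset[OF assms(6)] by auto
  define \<iota> where "\<iota> = e \<circ> (to_nat :: int \<Rightarrow> nat)"
  have inj: "inj \<iota>" using \<open>inj e\<close> by (simp add: \<iota>_def inj_compose)
  define act where "act g i = dihedral_act (2 * fst (f g), snd (f g)) i" for g i
  have act_mult: "act (g \<otimes>\<^bsub>G\<^esub> h) i = act g (act h i)" if "g \<in> carrier G" "h \<in> carrier G" for g h i
    using that by (simp add: act_def dihedral_act_def dihedral_mult)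
  have act_one: "act \<one>\<^bsub>G\<^esub> i = i" for i
    by (simp add: act_def dihedral_act_def) (simp add: infinite_dihedral_group_def)
  define \<phi> where "\<phi> g = (\<lambda>v\<in>range \<iota>. \<iota> (act g (inv_into UNIV \<iota> v)))" for g
  have \<phi>: "\<phi> g (\<iota> i) = \<iota> (act g i)" for g i by (simp add: \<phi>_def inj)
  have Bij: "\<phi> g \<in> Bij (range \<iota>)" if g: "g \<in> carrier G" for g
  proof -
    have "\<phi> g (\<phi> (inv\<^bsub>G\<^esub> g) v) = v" "\<phi> (inv\<^bsub>G\<^esub> g) (\<phi> g v) = v" if "v \<in> range \<iota>" for v
      using that g by (auto simp: \<phi> act_one simp flip: act_mult)
    moreover have "\<phi> h v \<in> range \<iota>" if "v \<in> range \<iota>" for h v using that by (auto simp: \<phi>)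
    ultimately have "bij_betw (\<phi> g) (range \<iota>) (range \<iota>)"
      by (intro bij_betwI[of _ _ _ "\<phi> (inv\<^bsub>G\<^esub> g)"]) auto
    then show ?thesis by (simp add: Bij_def \<phi>_def)
  qed
  have "\<phi> \<in> hom G (BijGroup (range \<iota>))"
  proof (rule homI)
    show "\<phi> (g \<otimes>\<^bsub>G\<^esub> h) = \<phi> g \<otimes>\<^bsub>BijGroup (range \<iota>)\<^esub> \<phi> h" if "g \<in> carrier G" "h \<in> carrier G" for g h
    proof
      fix v
      show "\<phi> (g \<otimes>\<^bsub>G\<^esub> h) v = (\<phi> g \<otimes>\<^bsub>BijGroup (range \<iota>)\<^esub> \<phi> h) v"
      proof (cases "v \<in> range \<iota>")
        case True
        then show ?thesis using that Bij by (auto simp: BijGroup_def compose_def \<phi> act_mult)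
      next
        case False
        then show ?thesis using that Bij by (simp add: BijGroup_def compose_def \<phi>_def)
      qed
    qed
  qed (simp add: BijGroup_def Bij)
  then have action: "group_action G (range \<iota>) \<phi>"
    by (simp add: group_action_def group_hom_def group_hom_axioms_def group_BijGroup G.is_group)
  interpret T: simplicial_tree "integer_line \<iota>" by (rule simplicial_tree_integer_line[OF inj])
  have "simplicial_tree_action (integer_line \<iota>) G \<phi>"
  proof (intro simplicial_tree_action.intro simplicial_tree_action_axioms.intro T.simplicial_tree_axioms)
    show "group_action G (pverts (integer_line \<iota>)) \<phi>" using action by (simp add: integer_line_def)
  next
    fix g x y assume "(x, y) \<in> parcs (integer_line \<iota>)"
    then obtain i j where ij: "x = \<iota> i" "y = \<iota> j" "\<bar>i - j\<bar> = 1" by (auto simp: integer_line_def)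
    have "\<bar>act g i - act g j\<bar> = 1" using ij(3) by (auto simp: act_def dihedral_act_def)
    then show "(\<phi> g x, \<phi> g y) \<in> parcs (integer_line \<iota>)"
      by (auto simp: ij \<phi> integer_line_def)
    have "\<not> (act g i = j \<and> act g j = i)"
      using ij(3) by (auto simp: act_def dihedral_act_def) presburger+
    then show "\<not> (\<phi> g x = y \<and> \<phi> g y = x)" using inj by (simp add: ij \<phi> inj_eq)
  qed
  moreover have "fixed_vertices (integer_line \<iota>) G \<phi> = {}"
  proof -
    have "\<phi> w (\<iota> i) \<noteq> \<iota> i" for i
      using w inj by (simp add: \<phi> inj_eq act_def dihedral_act_def)
    then show ?thesis using w(1) by (auto simp: fixed_vertices_def integer_line_def)
  qed
  ultimately show ?thesis unfolding property_FA_def by blast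
qed

section \<open>Branch groups\<close>

lemma (in branch_structure) subgroup_factor:
  assumes "j \<in> {1..\<Prod>i\<le>n. k i}"
  shows "subgroup (W n j) G"
proof -
  have "W n j \<lhd> G\<lparr>carrier := R n\<rparr>"
    using direct_product assms by (auto simp: internal_direct_product_def)
  then have "subgroup (W n j) (G\<lparr>carrier := R n\<rparr>)" by (rule normal_imp_subgroup)
  then show ?thesis using incl_subgroup[OF subgroup_R] by blast
qed

text \<open>
  Two normal subgroups of \<open>R n\<close> with trivial intersection commute.
\<close>

lemma (in branch_structure) factors_commute:
  assumes i: "i \<in> {1..\<Prod>i\<le>n. k i}" and j: "j \<in> {1..\<Prod>i\<le>n. k i}" and "i \<noteq> j"
    and x: "x \<in> W n i" and y: "y \<in> W n j"
  shows "x \<otimes> y = y \<otimes> x"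
proof -
  let ?I = "{1..\<Prod>i\<le>n. k i}"
  have nrm: "W n i \<lhd> G\<lparr>carrier := R n\<rparr>" "W n j \<lhd> G\<lparr>carrier := R n\<rparr>"
    and triv: "W n i \<inter> generate G (\<Union>m\<in>?I - {i}. W n m) = {\<one>}"
    using direct_product[of n] i j by (auto simp: internal_direct_product_def)
  have "W n j \<subseteq> generate G (\<Union>m\<in>?I - {i}. W n m)"
    using j \<open>i \<noteq> j\<close> by (blast intro: generate.incl)
  then have "W n i \<inter> W n j \<subseteq> {\<one>}" using triv by blast
  then show ?thesis
    using group.normal_imp_commuting[OF subgroup.subgroup_is_group[OF subgroup_R is_group] nrm _ x y] by simp
qed

lemma (in branch_structure) factors_conjugate:
  assumes i: "i \<in> {1..\<Prod>i\<le>n. k i}" and j: "j \<in> {1..\<Prod>i\<le>n. k i}"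
  shows "\<exists>g\<in>carrier G. \<forall>x\<in>W n i. g \<otimes> x \<otimes> inv g \<in> W n j"
proof -
  let ?E = "W n ` {1..\<Prod>i\<le>n. k i}"
  interpret conj: transitive_action G ?E "\<lambda>g. \<lambda>H\<in>?E. g <# H #> inv g"
    by (rule transitive_on_factors)
  have E: "W n i \<in> ?E" "W n j \<in> ?E" using i j by blast+
  obtain g where g: "g \<in> carrier G" "(\<lambda>H\<in>?E. g <# H #> inv g) (W n i) = W n j"
    using conj.unique_orbit[OF E] by blast
  then have "g <# W n i #> inv g = W n j" using E(1) by (metis restrict_apply')
  then have "\<forall>x\<in>W n i. g \<otimes> x \<otimes> inv g \<in> W n j"
    by (auto simp: l_coset_def r_coset_def)
  then show ?thesis using g(1) by blast
qed

theorem theorem1: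
  fixes G :: "('a, 'b) monoid_scheme"
  assumes "branch_group G"
    and "finitely_generated_group G"
    and "infinite (UNIV :: 'v set)"
  shows "property_FA TYPE('v) G \<longleftrightarrow>
    (\<nexists>f. f \<in> epi G integer_group) \<and> (\<nexists>f. f \<in> epi G infinite_dihedral_group)"
proof
  have grp: "group G" using assms(2) by (simp add: finitely_generated_group_def)
  assume FA: "property_FA TYPE('v) G"
  have no_translation: "f w \<noteq> (1, False)" if "f \<in> hom G infinite_dihedral_group" "w \<in> carrier G" for f w
    using translation_hom_not_FA[OF that(1) that(2) _ _ grp assms(3), of 1] FA by auto
  have "f \<notin> epi G integer_group" for f
  proof
    assume f: "f \<in> epi G integer_group"
    then have hom: "f \<in> hom G integer_group" by (simp add: epi_def)
    \<comment> \<open>the integers are the subgroup of translations of the dihedral group\<close>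
    have "(\<lambda>g. (f g, False)) \<in> hom G infinite_dihedral_group"
      by (intro homI) (use hom_mult[OF hom] in \<open>simp_all add: dihedral_mult\<close>)
    then have "f w \<noteq> 1" if "w \<in> carrier G" for w
      using no_translation[of _ w] that by fastforce
    moreover have "1 \<in> f ` carrier G" using f by (simp add: epi_def)
    ultimately show False by auto
  qed
  moreover have "f \<notin> epi G infinite_dihedral_group" for f
  proof
    assume f: "f \<in> epi G infinite_dihedral_group"
    then have "(1, False) \<in> f ` carrier G" by (simp add: epi_def)
    then show False using f no_translation by (fastforce simp: epi_def)
  qed
  ultimately show "(\<nexists>f. f \<in> epi G integer_group) \<and> (\<nexists>f. f \<in> epi G infinite_dihedral_group)"
    by blast
next
  assume no_epi: "(\<nexists>f. f \<in> epi G integer_group) \<and> (\<nexists>f. f \<in> epi G infinite_dihedral_group)"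
  have grp: "group G" using assms(2) by (simp add: finitely_generated_group_def)
  obtain k R V W where "branch_structure G k R V W" using assms(1) by (auto simp: branch_group_def)
  then interpret B: branch_structure G k R V W .
  show "property_FA TYPE('v) G"
    unfolding property_FA_def
  proof (intro allI impI)
    fix T :: "'v pair_pre_digraph" and \<phi>
    assume "simplicial_tree_action T G \<phi>"
    then interpret A: simplicial_tree_action T G \<phi> .
    have "A.elliptic h" if h: "h \<in> carrier G" for h
    proof (rule ccontr)
      assume hyp: "\<not> A.elliptic h"
      \<comment> \<open>level 1 is the first with at least two factors\<close>
      let ?J = "{1..\<Prod>i\<le>1. k i}"
      have J: "1 \<in> ?J" "2 \<in> ?J" using B.k_0 B.k_ge_2[of 1] by auto
      have R: "R 1 = generate G (\<Union>j\<in>?J. W 1 j)"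
        using B.direct_product[of 1] by (simp add: internal_direct_product_def)
      show False
      proof (rule A.invariant_line_of_commuting_conjugates[OF B.normal_R B.finite_index R _ J _ _ _ _ h hyp])
        show "x \<otimes>\<^bsub>G\<^esub> y = y \<otimes>\<^bsub>G\<^esub> x"
          if "i \<in> ?J" "j \<in> ?J" "i \<noteq> j" "x \<in> W 1 i" "y \<in> W 1 j" for i j x y
          using that by (rule B.factors_commute)
      next
        fix a w
        assume "A.line a" "\<And>g. g \<in> carrier G \<Longrightarrow> \<phi> g ` range a \<subseteq> range a"
          and w: "w \<in> carrier G" "\<not> A.elliptic w"
        then obtain f c where "f \<in> hom G infinite_dihedral_group" "f w = (c, False)" "c \<noteq> 0"
          using A.line_hom_dihedral by blast
        then show False using dihedral_hom_epi[OF _ w(1) _ _ grp] no_epi by blast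
      qed (simp, simp, (erule B.subgroup_factor B.factors_conjugate, assumption?)+)
    qed
    then show "fixed_vertices T G \<phi> \<noteq> {}"
      by (rule A.finitely_generated_elliptic_fixpoint[OF assms(2)])
  qed
qed

end
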